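(* Let $B_4,\gamma,\lambda>0$, let $x^*\in\mathbb{S}^{d-1}$ be fixed, and let $\mathcal D$ be a distribution on $\mathbb{R}^d$ such that $\mathbb{E}_{z\sim\mathcal D}[zz^\top\mathbf 1\{x^*\cdot z\ge\gamma\}]\succeq\lambda I$ and $\mathbb{E}_{z\sim\mathcal D}[(\rho\cdot z)^4]\le B_4$ for every unit vector $\rho$. Let $0<a\le b$ and let $\sigma\in\mathcal F_{(a,b)}$ be any $(a,b)$-unbounded activation. For $x\in\mathbb{S}^{d-1}$ write $\theta=\theta(x,x^* )$. Then: 1. (Surrogate loss) Let $f_{\mathrm{sur}}(x)=\mathbb{E}_{z\sim\mathcal D}\big[\int_0^{x\cdot z}(\sigma(s)-\sigma(x^*\cdot z))\,ds\big]$. Every $g(x)\in\partial^{C,R}f_{\mathrm{sur}}(x)$ is $\frac{a\lambda}{8b\sqrt{B_4}}$-RGA at $(x,x^* )$ when $$0<\theta\le\min\Big\{\arctan\Big(\frac{a\lambda}{4b\sqrt{B_4}}\Big),\ \arctan\Big(\gamma\sqrt{\frac{\lambda}{4B_4}}\Big)\Big\}.$$ 2. ($L_2^2$ loss) Let $f_{2}(x)=\mathbb{E}_{z\sim\mathcal D}\big[\tfrac12(\sigma(x\cdot z)-\sigma(x^*\cdot z))^2\big]$. Every $g(x)\in\partial^{C,R}f_{2}(x)$ is $\frac{a^2\lambda}{8b^2\sqrt{B_4}}$-RGA at $(x,x^* )$ when $$0<\theta\le\min\Big\{\arctan\Big(\frac{a^2\lambda}{4b^2\sqrt{B_4}}\Big),\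 \arctan\Big(\gamma\sqrt{\frac{\lambda}{4B_4}}\Big)\Big\}.$$ 3. ($\alpha$-Huber loss) Let $\alpha>0$, $h_{\mathrm{Hub}}(u)=\frac{u^2}{2}\mathbf 1\{|u|\le\alpha\}+\alpha(|u|-\alpha/2)\mathbf 1\{|u|>\alpha\}$ and $f_{\mathrm{Hub}}(x)=\mathbb{E}_{z\sim\mathcal D}[h_{\mathrm{Hub}}(\sigma(x\cdot z)-\sigma(x^*\cdot z))]$. Every $g(x)\in\partial^{C,R}f_{\mathrm{Hub}}(x)$ is $\frac{a^2\lambda}{8b^2\sqrt{B_4}}$-RGA at $(x,x^* )$ when $$0<\theta\le\min\Big\{\arctan\Big(\frac{a^2\lambda}{4b^2\sqrt{B_4}}\Big),\ \arctan\Big(\frac\gamma2\sqrt{\frac{\lambda}{B_4}}\Big),\ \arcsin\Big(\min\Big\{1,\frac{\alpha}{8b}\sqrt{\frac{\lambda}{B_4}}\Big\}\Big)\Big\}.$$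
   Context: $\mathbb{S}^{d-1}$ is the unit sphere of $\mathbb{R}^d$; $\theta(x,y)=\arccos(x\cdot y)$ for unit vectors. $\mathcal F_{(a,b)}$ is the set of $\sigma:\mathbb{R}\to\mathbb{R}$ (Lipschitz) with $0\le\sigma'(s)\le b$ and $\sigma'(s)\ge a$ whenever $s>0$; at points of nondifferentiability the inequalities apply to all elements of the Clarke subdifferential. For a locally Lipschitz $f$, $\partial^Cf(x)$ is the Clarke subdifferential (convex hull of limits of gradients at differentiability points $y_k\to x$) and $\partial^{C,R}f(x)=\{(I-xx^\top)\xi:\xi\in\partial^Cf(x)\}$. A tangent vector $g(x)\perp x$ is $\mu$-RGA at $(x,x^* )$ if $g(x)\ne0$ whenever $x\neq x^*$ and $g(x)\cdot x^*\le-\mu\,\sin(\theta(x,x^* ))\,\|g(x)\|_2$. *)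

theory Defs
  imports "HOL-Probability.Probability"
begin

definition sph_angle :: "'a::real_inner \<Rightarrow> 'a \<Rightarrow> real" where
  "sph_angle x y = arccos (x \<bullet> y)"

definition outer :: "real^'m \<Rightarrow> real^'n \<Rightarrow> real^'n^'m" where
  "outer x y = (\<chi> i j. x $ i * y $ j)"

definition loewner_ge :: "real^'n^'n \<Rightarrow> real^'n^'n \<Rightarrow> bool" where
  "loewner_ge A B \<longleftrightarrow>
     transpose (A - B) = A - B \<and> (\<forall>v. 0 \<le> v \<bullet> ((A - B) *v v))"

text \<open>The points of differentiability converging to \<open>x\<close> are allowed to coincide with \<open>x\<close>.
  For \<open>'a = real\<close> the gradient is the ordinary derivative.\<close>

definition clarke_subdiff :: "('a::euclidean_space \<Rightarrow> real) \<Rightarrow> 'a \<Rightarrow> 'a set" where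
  "clarke_subdiff f x = convex hull
     {\<xi>. \<exists>y G. y \<longlonglongrightarrow> x \<and> (\<forall>k::nat. GDERIV f (y k) :> G k) \<and> G \<longlonglongrightarrow> \<xi>}"

definition riem_clarke_subdiff :: "(real^'d \<Rightarrow> real) \<Rightarrow> real^'d \<Rightarrow> (real^'d) set" where
  "riem_clarke_subdiff f x = (\<lambda>\<xi>. (mat 1 - outer x x) *v \<xi>) ` clarke_subdiff f x"

definition RGA :: "real \<Rightarrow> 'a::real_inner \<Rightarrow> 'a \<Rightarrow> 'a \<Rightarrow> bool" where
  "RGA \<mu> x xs g \<longleftrightarrow>
     g \<bullet> x = 0 \<and> (x \<noteq> xs \<longrightarrow> g \<noteq> 0) \<and>
     g \<bullet> xs \<le> - \<mu> * sin (sph_angle x xs) * norm g"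

definition unbounded_activations :: "real \<Rightarrow> real \<Rightarrow> (real \<Rightarrow> real) set" where
  "unbounded_activations a b = {\<sigma>.
     (\<exists>L. L-lipschitz_on UNIV \<sigma>) \<and>
     (\<forall>s. \<sigma> differentiable (at s) \<longrightarrow>
        0 \<le> deriv \<sigma> s \<and> deriv \<sigma> s \<le> b \<and> (s > 0 \<longrightarrow> a \<le> deriv \<sigma> s)) \<and>
     (\<forall>s. \<not> \<sigma> differentiable (at s) \<longrightarrow>
        (\<forall>\<xi>\<in>clarke_subdiff \<sigma> s. 0 \<le> \<xi> \<and> \<xi> \<le> b \<and> (s > 0 \<longrightarrow> a \<le> \<xi>)))}"

text \<open>The inner integral is oriented: it changes sign when \<open>x \<bullet> z < 0\<close>.\<close>

definition f_sur :: "(real^'d) measure \<Rightarrow> (real \<Rightarrow> real) \<Rightarrow> real^'d \<Rightarrow> real^'d \<Rightarrow> real" where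
  "f_sur D \<sigma> xs x =
     (\<integral>z. (LBINT s=ereal 0..ereal (x \<bullet> z). \<sigma> s - \<sigma> (xs \<bullet> z)) \<partial>D)"

definition f_L2 :: "(real^'d) measure \<Rightarrow> (real \<Rightarrow> real) \<Rightarrow> real^'d \<Rightarrow> real^'d \<Rightarrow> real" where
  "f_L2 D \<sigma> xs x = (\<integral>z. 1/2 * (\<sigma> (x \<bullet> z) - \<sigma> (xs \<bullet> z))\<^sup>2 \<partial>D)"

definition huber :: "real \<Rightarrow> real \<Rightarrow> real" where
  "huber \<alpha> u = u\<^sup>2 / 2 * of_bool (\<bar>u\<bar> \<le> \<alpha>) + \<alpha> * (\<bar>u\<bar> - \<alpha> / 2) * of_bool (\<bar>u\<bar> > \<alpha>)"

definition f_Hub ::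
  "(real^'d) measure \<Rightarrow> (real \<Rightarrow> real) \<Rightarrow> real \<Rightarrow> real^'d \<Rightarrow> real^'d \<Rightarrow> real" where
  "f_Hub D \<sigma> \<alpha> xs x = (\<integral>z. huber \<alpha> (\<sigma> (x \<bullet> z) - \<sigma> (xs \<bullet> z)) \<partial>D)"

end

theory Submission
  imports Defs
begin

text \<open>
  Write \<open>\<theta>\<close> for the angle between \<open>x\<close> and \<open>xs\<close>, \<open>c = cos \<theta>\<close>, \<open>r = sin \<theta>\<close>, and let \<open>v = xs - c x\<close> be the
  projection of \<open>xs\<close> to the tangent space at \<open>x\<close>, so that \<open>norm v = r\<close>. For \<open>g = (I - x x\<^sup>T) \<xi>\<close> with \<open>\<xi>\<close> in the
  Clarke subdifferential, the inner product of \<open>g\<close> with \<open>xs\<close> is \<open>\<xi> \<bullet> v\<close> and \<open>norm g \<le> norm \<xi>\<close>. It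
  therefore suffices to show \<open>\<xi> \<bullet> v \<le> - M r\<^sup>2\<close> and \<open>norm \<xi> \<le> N r\<close>, with \<open>M / N\<close> the required constant.
  Both conditions are convex in \<open>\<xi>\<close>, so only limits of gradients matter.

  All three losses have the form \<open>E \<Phi>(x \<bullet> z, xs \<bullet> z)\<close>. Formally the gradient is
  \<open>E s g(\<sigma> (x \<bullet> z) - \<sigma> (xs \<bullet> z)) z\<close>, where \<open>g\<close> is the identity or clipping at \<open>\<alpha>\<close>, and \<open>s\<close> is \<open>1\<close> for the
  surrogate loss and a slope of \<open>\<sigma>\<close> at \<open>x \<bullet> z\<close> for the other two. As \<open>\<sigma>\<close> need not be differentiable, the lemma
  \<open>limiting_gradient_le\<close> works with difference quotients at base points tending to \<open>x\<close>: a bound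
  valid for every admissible \<open>s\<close> can be integrated to a bound on a limiting gradient.

  The descent estimate \<open>pointwise_descent\<close> compares \<open>\<sigma> (xs \<bullet> z)\<close> with \<open>\<sigma> ((xs \<bullet> z) / c)\<close>. Since
  \<open>v \<bullet> z = c ((xs \<bullet> z) / c - x \<bullet> z)\<close>, monotonicity of \<open>\<sigma>\<close> and \<open>g\<close> makes the compared integrand nonpositive,
  and at most a negative multiple of \<open>(v \<bullet> z)\<^sup>2\<close> where both inputs are positive and \<open>g\<close> acts as the
  identity. The error of the comparison is of order \<open>tan \<theta> sin\<^sup>2 \<theta>\<close>. The hypothesis on the
  second-moment matrix bounds the expectation of \<open>(v \<bullet> z)\<^sup>2\<close> over \<open>xs \<bullet> z \<ge> \<gamma>\<close> from below by \<open>lam r\<^sup>2\<close>, and the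
  fourth moments control the part lost where \<open>x \<bullet> z \<le> 0\<close> or \<open>g\<close> truncates. The norm bound is the
  Lipschitz bound \<open>\<bar>\<sigma> (x \<bullet> z) - \<sigma> (xs \<bullet> z)\<bar> \<le> b \<bar>(x - xs) \<bullet> z\<bar>\<close> together with
  \<open>norm (x - xs) \<le> 2 r\<close>.

  The slopes of \<open>\<sigma>\<close> must first be bounded from information on its derivative where that exists.
  This is \<open>lipschitz_slope_ge\<close>, whose proof contains the almost everywhere differentiability
  of Lipschitz functions on the line, obtained from Vitali's covering theorem.
\<close>

section \<open>Lipschitz functions on the line with bounded derivative\<close>

text \<open>\<open>steep F c\<close> is the set of points lying in arbitrarily short open intervals on which the
  slope of \<open>F\<close> exceeds \<open>c\<close>: the upper limit of the slopes is at least \<open>c\<close> there, and every point where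
  it is larger than \<open>c\<close> belongs to the set. Using open intervals that contain the point, rather than
  difference quotients based at it, makes this a \<open>G\<^sub>\<delta>\<close> set, hence Borel.\<close>

definition steep :: "(real \<Rightarrow> real) \<Rightarrow> real \<Rightarrow> real set" where
  "steep F c = (\<Inter>n. \<Union>{{p<..<q} | p q. p < q \<and> q - p < 1 / real (Suc n) \<and> c * (q - p) < F q - F p})"

lemma steep_iff:
  "x \<in> steep F c \<longleftrightarrow> (\<forall>d>0. \<exists>p q. p < x \<and> x < q \<and> q - p < d \<and> c * (q - p) < F q - F p)"
  (is "_ \<longleftrightarrow> ?R")
proof
  assume x: "x \<in> steep F c"
  show ?R
  proof (intro allI impI)
    fix d :: real assume "d > 0"
    then obtain n where n: "1 / real (Suc n) < d"
      using nat_approx_posE by blast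
    from x have "x \<in> \<Union>{{p<..<q} | p q. p < q \<and> q - p < 1 / real (Suc n) \<and> c * (q - p) < F q - F p}"
      unfolding steep_def by (rule INT_D) simp
    then obtain p q where "p < x" "x < q" "q - p < 1 / real (Suc n)" "c * (q - p) < F q - F p"
      by auto
    with n show "\<exists>p q. p < x \<and> x < q \<and> q - p < d \<and> c * (q - p) < F q - F p"
      by (meson less_trans)
  qed
next
  assume R: ?R
  show "x \<in> steep F c"
    unfolding steep_def
  proof (rule INT_I)
    fix n
    have "0 < 1 / real (Suc n)" by simp
    then obtain p q where "p < x" "x < q" "q - p < 1 / real (Suc n)" "c * (q - p) < F q - F p"
      using R by blast
    then show "x \<in> \<Union>{{p<..<q} | p q. p < q \<and> q - p < 1 / real (Suc n) \<and> c * (q - p) < F q - F p}"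
      by (intro UnionI[of "{p<..<q}"] CollectI exI[of _ p] exI[of _ q]) auto
  qed
qed

lemma steep_borel [measurable]: "steep F c \<in> sets borel"
proof -
  have "open (\<Union>{{p<..<q} | p q. p < q \<and> q - p < 1 / real (Suc n) \<and> c * (q - p) < F q - F p})" for n
    by (rule open_Union) auto
  then show ?thesis
    unfolding steep_def by auto
qed

lemma steep_antimono: "c \<le> c' \<Longrightarrow> steep F c' \<subseteq> steep F c"
  unfolding subset_iff steep_iff
proof (intro allI impI)
  fix x d :: real
  assume cc: "c \<le> c'" and "\<forall>d>0. \<exists>p q. p < x \<and> x < q \<and> q - p < d \<and> c' * (q - p) < F q - F p" and "0 < d"
  then obtain p q where pq: "p < x" "x < q" "q - p < d" "c' * (q - p) < F q - F p" by blast
  have "c * (q - p) \<le> c' * (q - p)" using cc pq by (intro mult_right_mono) auto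
  then have "c * (q - p) < F q - F p" using pq(4) by (rule le_less_trans)
  with pq show "\<exists>p q. p < x \<and> x < q \<and> q - p < d \<and> c * (q - p) < F q - F p"
    by (intro exI[of _ p] exI[of _ q]) auto
qed

text \<open>Functions all of whose slopes lie in \<open>[0, 1]\<close>. Every Lipschitz function on the line is of this
  form up to an affine change, and the class is closed under \<open>F \<mapsto> (\<lambda>x. x - F x)\<close>, which
  exchanges upper and lower bounds on slopes.\<close>

locale unit_slope =
  fixes F :: "real \<Rightarrow> real"
  assumes mono: "\<And>p q. p \<le> q \<Longrightarrow> F p \<le> F q"
    and slope_le_1: "\<And>p q. p \<le> q \<Longrightarrow> F q - F p \<le> q - p"
begin

lemma abs_diff_le: "\<bar>F q - F p\<bar> \<le> \<bar>q - p\<bar>"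
  using mono[of p q] slope_le_1[of p q] mono[of q p] slope_le_1[of q p] by (cases "p \<le> q") auto

lemma continuous: "continuous_on UNIV F"
proof (rule continuous_onI)
  fix x e :: real assume "e > 0"
  then show "\<exists>d>0. \<forall>x'\<in>UNIV. dist x' x < d \<longrightarrow> dist (F x') (F x) \<le> e"
    using abs_diff_le by (intro exI[of _ e]) (smt (verit) dist_real_def)
qed

lemma cont_right: "continuous (at_right a) F"
  using continuous by (simp add: continuous_on_eq_continuous_at continuous_at_imp_continuous_at_within)

lemma emeasure_Ioo:
  assumes "p \<le> q" shows "emeasure (interval_measure F) {p<..<q} = ennreal (F q - F p)"
proof -
  have null: "{q} \<in> null_sets (interval_measure F)"
    using emeasure_interval_measure_Icc[of q q F, OF _ mono continuous] by (auto simp: null_sets_def)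
  show ?thesis
  proof (cases "p < q")
    case True
    then have "{p<..q} = {p<..<q} \<union> {q}" by auto
    then have "emeasure (interval_measure F) {p<..<q} = emeasure (interval_measure F) {p<..q}"
      using null emeasure_Un_null_set[of "{p<..<q}" "interval_measure F" "{q}"] by simp
    then show ?thesis
      using emeasure_interval_measure_Ioc[OF assms mono cont_right] by simp
  qed (use assms in simp)
qed

lemma compl: "unit_slope (\<lambda>x. x - F x)"
proof
  fix p q :: real assume "p \<le> q"
  from mono[OF this] slope_le_1[OF this]
  show "p - F p \<le> q - F q" "(q - F q) - (p - F p) \<le> q - p" by linarith+
qed

text \<open>The Stieltjes measures of \<open>F\<close> and of \<open>\<lambda>x. x - F x\<close> add up to Lebesgue measure, because they do
  so on intervals. In particular the Stieltjes measure of \<open>F\<close> is dominated by Lebesgue measure.\<close>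

lemma measure_add_compl:
  assumes "A \<in> sets borel"
  shows "emeasure lborel A = emeasure (interval_measure F) A + emeasure (interval_measure (\<lambda>x. x - F x)) A"
proof -
  interpret G: unit_slope "\<lambda>x. x - F x" by (rule compl)
  let ?h = "\<lambda>A. emeasure (interval_measure F) A + emeasure (interval_measure (\<lambda>x. x - F x)) A"
  define N where "N = measure_of UNIV (sets (borel :: real measure)) ?h"
  have sN: "sets N = sets borel"
    unfolding N_def by (metis sets.sets_measure_of_eq space_borel)
  have eN: "emeasure N A = ?h A" if "A \<in> sets borel" for A
  proof (rule emeasure_measure_of[OF N_def])
    show "sets borel \<subseteq> Pow (UNIV :: real set)" by simp
    show "A \<in> sets N" using that sN by simp
    show "positive (sets N) ?h" by (simp add: positive_def)
    show "countably_additive (sets N) ?h"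
      unfolding countably_additive_def
    proof (intro allI impI)
      fix B :: "nat \<Rightarrow> real set" assume B: "range B \<subseteq> sets N" "disjoint_family B"
      then show "(\<Sum>i. ?h (B i)) = ?h (\<Union>i. B i)"
        using sN by (subst suminf_add[symmetric]) (auto simp: suminf_emeasure)
    qed
  qed
  have "lborel = N"
  proof (rule lborel_eqI)
    fix l u :: real assume "\<And>b. b \<in> Basis \<Longrightarrow> l \<bullet> b \<le> u \<bullet> b"
    then have lu: "l \<le> u" by simp
    have "emeasure N {l<..<u} = ennreal (F u - F l) + ennreal ((u - F u) - (l - F l))"
      using emeasure_Ioo[OF lu] G.emeasure_Ioo[OF lu] by (simp add: eN)
    also have "\<dots> = ennreal (u - l)"
      using mono[OF lu] slope_le_1[OF lu] by (simp flip: ennreal_plus)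
    finally show "emeasure N (box l u) = (\<Prod>b\<in>Basis. (u - l) \<bullet> b)"
      by (simp add: box_real)
  qed (simp add: sN)
  then show ?thesis using eN[OF assms] by simp
qed

lemma emeasure_le_lborel:
  "A \<in> sets borel \<Longrightarrow> emeasure (interval_measure F) A \<le> emeasure lborel A"
  by (simp add: measure_add_compl)

text \<open>Vitali's covering theorem: almost all of \<open>S\<close> is covered by disjoint intervals, inside an open set
  barely larger than \<open>S\<close>, on each of which \<open>F\<close> increases by more than \<open>c\<close> times the length.\<close>

lemma steep_measure_ge:
  assumes S: "S \<in> sets borel" "S \<subseteq> steep F c"
  shows "ennreal c * emeasure lborel S \<le> emeasure (interval_measure F) S"
proof (cases "c \<le> 0")
  case True then show ?thesis by (simp add: ennreal_neg)
next
  case False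
  then have c0: "0 < c" by simp
  let ?m = "interval_measure F"
  show ?thesis
  proof (rule ennreal_le_epsilon)
    fix e :: real assume e: "0 < e"
    obtain U where U: "open U" "S \<subseteq> U" "U - S \<in> lmeasurable" "emeasure lebesgue (U - S) < ennreal e"
      using sets_lebesgue_outer_open[OF _ e, of S] S by auto
    define K where "K = {(a, r). 0 < r \<and> cball a r \<subseteq> U \<and> c * (2 * r) < F (a + r) - F (a - r)}"
    have V: "\<exists>i. i \<in> K \<and> x \<in> ball (fst i) (snd i) \<and> snd i < d" if "x \<in> S" "0 < d" for x d
    proof -
      obtain e' where e': "e' > 0" "ball x e' \<subseteq> U" using U \<open>x \<in> S\<close> openE by blast
      have "x \<in> steep F c" "0 < min d e'" using S that e' by auto
      then obtain p q where pq: "p < x" "x < q" "q - p < min d e'" "c * (q - p) < F q - F p"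
        unfolding steep_iff by blast
      define i where "i = ((p + q) / 2, (q - p) / 2)"
      have "cball ((p + q) / 2) ((q - p) / 2) \<subseteq> ball x e'"
        using pq by (auto simp: dist_real_def abs_if field_simps split: if_splits)
      then have "i \<in> K" using pq e' by (auto simp: K_def i_def field_simps)
      moreover have "x \<in> ball (fst i) (snd i)" using pq by (auto simp: i_def dist_real_def abs_if field_simps)
      ultimately show ?thesis using pq by (intro exI[of _ i]) (auto simp: i_def)
    qed
    obtain C where C: "countable C" "C \<subseteq> K"
      "pairwise (\<lambda>i j. disjnt (ball (fst i) (snd i)) (ball (fst j) (snd j))) C"
      "negligible (S - (\<Union>i\<in>C. ball (fst i) (snd i)))"
      by (rule Vitali_covering_theorem_balls[of S K fst snd, OF V]) assumption
    let ?B = "\<lambda>i. ball (fst i) (snd i) :: real set"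
    let ?W = "\<Union>i\<in>C. ?B i"
    have dis: "disjoint_family_on ?B C"
      using C(3) by (auto simp: disjoint_family_on_def pairwise_def disjnt_def)
    have Wo: "open ?W" by auto
    have nul: "emeasure lborel (S - ?W) = 0"
      using C(4) S Wo by (auto simp: negligible_iff_null_sets null_sets_def)
    have "emeasure lborel S \<le> emeasure lborel (?W \<union> (S - ?W))"
      using S Wo by (intro emeasure_mono) auto
    also have "\<dots> \<le> emeasure lborel ?W + emeasure lborel (S - ?W)"
      using S Wo by (intro emeasure_subadditive) auto
    finally have 1: "emeasure lborel S \<le> emeasure lborel ?W" using nul by simp
    have "ennreal c * emeasure lborel S \<le> ennreal c * emeasure lborel ?W"
      using 1 by (rule mult_left_mono) simp
    also have "\<dots> = (\<integral>\<^sup>+i. ennreal c * emeasure lborel (?B i) \<partial>count_space C)"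
      using C(1) dis by (subst emeasure_UN_countable) (auto simp: nn_integral_cmult)
    also have "\<dots> \<le> (\<integral>\<^sup>+i. emeasure ?m (?B i) \<partial>count_space C)"
    proof (rule nn_integral_mono)
      fix i assume "i \<in> space (count_space C)"
      then have i: "i \<in> K" using C(2) by auto
      obtain a r where ar: "i = (a, r)" by (cases i)
      have B: "?B i = {a - r<..<a + r}" unfolding ar by (simp add: ball_eq_greaterThanLessThan)
      have r: "0 < r" "c * (2 * r) < F (a + r) - F (a - r)" using i by (auto simp: K_def ar)
      have "ennreal c * emeasure lborel (?B i) = ennreal (c * (2 * r))"
        using c0 r unfolding B by (simp add: ennreal_mult')
      also have "\<dots> \<le> emeasure ?m (?B i)"
        unfolding B using r by (subst emeasure_Ioo) (auto intro: ennreal_leI)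
      finally show "ennreal c * emeasure lborel (?B i) \<le> emeasure ?m (?B i)" .
    qed
    also have "\<dots> = emeasure ?m ?W"
      using C(1) dis by (subst emeasure_UN_countable) auto
    also have "\<dots> \<le> emeasure ?m U"
      using C(2) U(1) by (intro emeasure_mono) (fastforce simp: K_def)+
    also have "\<dots> = emeasure ?m (S \<union> (U - S))"
      using U(2) by (simp add: Un_absorb1)
    also have "\<dots> \<le> emeasure ?m S + emeasure ?m (U - S)"
      using S U by (intro emeasure_subadditive) auto
    also have "\<dots> \<le> emeasure ?m S + emeasure lborel (U - S)"
      using S U by (intro add_left_mono emeasure_le_lborel) auto
    also have "\<dots> \<le> emeasure ?m S + ennreal e"
      using U S by (intro add_left_mono) (auto simp: less_imp_le)
    finally show "ennreal c * emeasure lborel S \<le> emeasure ?m S + ennreal e" .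
  qed
qed

text \<open>A point of \<open>steep (\<lambda>x. x - F x) (1 - c)\<close> lies in arbitrarily short intervals on which the slope of
  \<open>F\<close> is below \<open>c\<close>. On the set of points where slopes both above \<open>C\<close> and below \<open>c < C\<close> recur, the two
  lower bounds on measures sum to more than the Lebesgue measure unless the set is null.\<close>

lemma null_steep_Int:
  assumes "c < C"
  shows "steep F C \<inter> steep (\<lambda>x. x - F x) (1 - c) \<in> null_sets lborel" (is "?N \<in> _")
proof -
  interpret G: unit_slope "\<lambda>x. x - F x" by (rule compl)
  have "?N \<inter> {-real n..real n} \<in> null_sets lborel" for n
  proof -
    let ?S = "?N \<inter> {-real n..real n}"
    let ?m = "emeasure (interval_measure F) ?S" and ?g = "emeasure (interval_measure (\<lambda>x. x - F x)) ?S"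
    have S: "?S \<in> sets borel" by simp
    have fin: "emeasure lborel ?S < \<infinity>"
      by (rule le_less_trans[OF emeasure_mono[of _ "{-real n..real n}"]]) auto
    have sum: "emeasure lborel ?S = ?m + ?g" using measure_add_compl[OF S] .
    have m1: "ennreal C * emeasure lborel ?S \<le> ?m" by (rule steep_measure_ge) auto
    have m2: "ennreal (1 - c) * emeasure lborel ?S \<le> ?g" by (rule G.steep_measure_ge) auto
    obtain l where l: "emeasure lborel ?S = ennreal l" "l \<ge> 0"
      using fin by (cases "emeasure lborel ?S") auto
    have "?m \<le> ennreal l" "?g \<le> ennreal l" using sum l by (metis le_iff_add add.commute)+
    then obtain m g where mg: "?m = ennreal m" "?g = ennreal g" "m \<ge> 0" "g \<ge> 0"
      by (cases "?m"; cases "?g") (auto simp: top_unique)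
    have "ennreal (C * l) \<le> ennreal m" "ennreal ((1 - c) * l) \<le> ennreal g"
      using m1 m2 mg l by (simp_all add: ennreal_mult'')
    then have "C * l \<le> m" "(1 - c) * l \<le> g" using mg l by (auto simp: ennreal_le_iff)
    moreover have "l = m + g" using sum mg l by (simp flip: ennreal_plus)
    ultimately have "(C - c) * l \<le> 0" by (simp add: algebra_simps)
    then have "l = 0" using assms l(2) by (simp add: mult_le_0_iff)
    then show ?thesis using l S by (auto simp: null_sets_def)
  qed
  then have "(\<Union>n. ?N \<inter> {-real n..real n}) \<in> null_sets lborel" by (intro null_sets_UN) auto
  moreover have "(\<Union>n. ?N \<inter> {-real n..real n}) = ?N"
  proof -
    have "\<exists>n. x \<in> {-real n..real n}" for x :: real
      using real_arch_simple[of "\<bar>x\<bar>"] by (simp add: abs_le_iff minus_le_iff conj_commute)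
    then show ?thesis by blast
  qed
  ultimately show ?thesis by simp
qed

text \<open>The points at which the slopes of \<open>F\<close> over short surrounding intervals do not settle down.\<close>

definition oscillating :: "real set" where
  "oscillating = (\<Union>(c, C) \<in> {(c, C). c \<in> \<rat> \<and> C \<in> \<rat> \<and> c < C}. steep F C \<inter> steep (\<lambda>x. x - F x) (1 - c))"

lemma oscillating_null: "oscillating \<in> null_sets lborel"
proof -
  have "countable {(c, C). (c::real) \<in> \<rat> \<and> (C::real) \<in> \<rat> \<and> c < C}"
    by (rule countable_subset[of _ "\<rat> \<times> \<rat>"]) (auto simp: countable_rat)
  then show ?thesis
    unfolding oscillating_def by (intro null_sets_UN') (auto intro!: null_steep_Int)
qed

text \<open>Off this null set \<open>F\<close> is differentiable, and the derivative is the supremum of all \<open>c\<close> such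
  that slopes above \<open>c\<close> recur.\<close>

lemma derivative_off_oscillating:
  assumes "x \<notin> oscillating"
  obtains D where "(F has_real_derivative D) (at x)" "\<And>c. c < D \<Longrightarrow> x \<in> steep F c"
proof -
  define Z where "Z = {c. x \<in> steep F c}"
  define D where "D = Sup Z"
  have ub: "c \<le> 1" if "c \<in> Z" for c
  proof (rule ccontr)
    assume "\<not> c \<le> 1"
    have "x \<in> steep F c" using that by (simp add: Z_def)
    then obtain p q where pq: "p < x" "x < q" "c * (q - p) < F q - F p"
      using zero_less_one unfolding steep_iff by blast
    have "1 * (q - p) \<le> c * (q - p)"
      using \<open>\<not> c \<le> 1\<close> pq by (intro mult_right_mono) auto
    also have "\<dots> < F q - F p" by (rule pq)
    also have "\<dots> \<le> q - p" using pq by (intro slope_le_1) simp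
    finally show False by simp
  qed
  then have bdd: "bdd_above Z" by (intro bdd_aboveI)
  have "x \<in> steep F (-1)"
    unfolding steep_iff
  proof (intro allI impI)
    fix d :: real assume "0 < d"
    then show "\<exists>p q. p < x \<and> x < q \<and> q - p < d \<and> -1 * (q - p) < F q - F p"
      using mono[of "x - d/3" "x + d/3"]
      by (intro exI[of _ "x - d/3"] exI[of _ "x + d/3"]) (auto simp: field_simps)
  qed
  then have ne: "Z \<noteq> {}" by (auto simp: Z_def)
  have below: "x \<in> steep F c" if c: "c < D" for c
  proof -
    obtain c' where "c' \<in> Z" "c < c'" using c ne bdd unfolding D_def by (metis less_cSup_iff)
    then show ?thesis using steep_antimono[of c c' F] by (auto simp: Z_def)
  qed
  have upper: "\<exists>d>0. \<forall>p q. p < x \<longrightarrow> x < q \<longrightarrow> q - p < d \<longrightarrow> F q - F p \<le> (D + e) * (q - p)" if e: "e > 0" for e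
  proof -
    have "D + e \<notin> Z" using cSup_upper[OF _ bdd, of "D + e"] e by (auto simp: D_def)
    then show ?thesis by (simp add: Z_def steep_iff) (meson not_less)
  qed
  have lower: "\<exists>d>0. \<forall>p q. p < x \<longrightarrow> x < q \<longrightarrow> q - p < d \<longrightarrow> (D - e) * (q - p) \<le> F q - F p" if e: "e > 0" for e
  proof -
    obtain C where C: "C \<in> \<rat>" "D - e < C" "C < D" using Rats_dense_in_real[of "D - e" D] e by auto
    obtain c where c: "c \<in> \<rat>" "D - e < c" "c < C" using Rats_dense_in_real[of "D - e" C] C by auto
    have "x \<notin> steep (\<lambda>x. x - F x) (1 - c)"
      using assms below[OF C(3)] C c unfolding oscillating_def by auto
    then obtain d where d: "d > 0" "\<And>p q. p < x \<Longrightarrow> x < q \<Longrightarrow> q - p < d \<Longrightarrow> (q - F q) - (p - F p) \<le> (1 - c) * (q - p)"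
      unfolding steep_iff by (meson not_less)
    have "(D - e) * (q - p) \<le> F q - F p" if pq: "p < x" "x < q" "q - p < d" for p q
    proof -
      have "c * (q - p) \<le> F q - F p" using d(2)[OF pq] by (simp add: algebra_simps)
      moreover have "(D - e) * (q - p) \<le> c * (q - p)" using c pq by (intro mult_right_mono) auto
      ultimately show ?thesis by linarith
    qed
    with d(1) show ?thesis by blast
  qed
  have tend: "((\<lambda>h. F (t + h) - F (s - h)) \<longlongrightarrow> F t - F s) (at_right 0)" for s t
  proof -
    have "isCont F y" for y using continuous by (simp add: continuous_on_eq_continuous_at)
    note F_tend = isCont_tendsto_compose[OF this]
    have "((\<lambda>h. t + h) \<longlongrightarrow> t) (at_right 0)" "((\<lambda>h. s - h) \<longlongrightarrow> s) (at_right 0)"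
      by (auto intro!: tendsto_eq_intros)
    then show ?thesis by (intro tendsto_diff F_tend)
  qed
  have "(F has_real_derivative D) (at x)"
    unfolding has_field_derivative_def has_derivative_at_alt
  proof (intro conjI allI impI)
    show "bounded_linear ((*) D)" by (rule bounded_linear_mult_right)
    fix e :: real assume e: "0 < e"
    obtain d1 where d1: "d1 > 0" "\<And>p q. p < x \<Longrightarrow> x < q \<Longrightarrow> q - p < d1 \<Longrightarrow> F q - F p \<le> (D + e) * (q - p)"
      using upper[OF e] by blast
    obtain d2 where d2: "d2 > 0" "\<And>p q. p < x \<Longrightarrow> x < q \<Longrightarrow> q - p < d2 \<Longrightarrow> (D - e) * (q - p) \<le> F q - F p"
      using lower[OF e] by blast
    let ?d = "min d1 d2"
    \<comment> \<open>Intervals with \<open>x\<close> as an end point are limits of open intervals around \<open>x\<close>.\<close>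
    have key: "\<bar>F t - F s - D * (t - s)\<bar> \<le> e * (t - s)" if st: "s \<le> x" "x \<le> t" "t - s < ?d" for s t
    proof -
      have ev: "\<forall>\<^sub>F h in at_right 0. h > 0 \<and> t + h - (s - h) < ?d"
      proof (rule eventually_mono)
        show "\<forall>\<^sub>F h in at_right 0. h \<in> {0<..<(?d - (t - s)) / 2}"
          using st by (intro eventually_at_right_real) simp
        show "h > 0 \<and> t + h - (s - h) < ?d" if "h \<in> {0<..<(?d - (t - s)) / 2}" for h
          using that by (simp add: field_simps del: min_less_iff_conj)
      qed
      have "F t - F s \<le> (D + e) * (t - s)"
      proof (rule tendsto_le[OF _ _ tend])
        show "((\<lambda>h. (D + e) * (t + h - (s - h))) \<longlongrightarrow> (D + e) * (t - s)) (at_right 0)"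
          by (auto intro!: tendsto_eq_intros)
        show "\<forall>\<^sub>F h in at_right 0. F (t + h) - F (s - h) \<le> (D + e) * (t + h - (s - h))"
          using ev
        proof eventually_elim
          case (elim h)
          with st show ?case by (intro d1(2)) auto
        qed
      qed simp
      moreover have "(D - e) * (t - s) \<le> F t - F s"
      proof (rule tendsto_le[OF _ tend])
        show "((\<lambda>h. (D - e) * (t + h - (s - h))) \<longlongrightarrow> (D - e) * (t - s)) (at_right 0)"
          by (auto intro!: tendsto_eq_intros)
        show "\<forall>\<^sub>F h in at_right 0. F (t + h) - F (s - h) \<ge> (D - e) * (t + h - (s - h))"
          using ev
        proof eventually_elim
          case (elim h)
          with st show ?case by (intro d2(2)) auto
        qed
      qed simp
      ultimately show ?thesis by (simp add: algebra_simps abs_le_iff)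
    qed
    have "norm (F y - F x - D * (y - x)) \<le> e * norm (y - x)" if "norm (y - x) < ?d" for y
      using key[of x y] key[of y x] that by (cases "x \<le> y") (auto simp: abs_if algebra_simps split: if_splits)
    then show "\<exists>d>0. \<forall>y. norm (y - x) < d \<longrightarrow> norm (F y - F x - D * (y - x)) \<le> e * norm (y - x)"
      using d1(1) d2(1) by (intro exI[of _ ?d]) auto
  qed
  then show thesis using that below by blast
qed

lemma slope_ge:
  assumes pq: "p < q" and d: "\<And>s D. p < s \<Longrightarrow> s < q \<Longrightarrow> (F has_real_derivative D) (at s) \<Longrightarrow> c \<le> D"
  shows "c * (q - p) \<le> F q - F p"
proof (rule field_le_epsilon)
  fix e :: real assume e: "0 < e"
  define c' where "c' = c - e / (q - p)"
  have c': "c' < c" using e pq by (simp add: c'_def)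
  let ?S = "{p<..<q} \<inter> steep F c'"
  have "{p<..<q} - ?S \<subseteq> oscillating"
  proof
    fix x assume x: "x \<in> {p<..<q} - ?S"
    show "x \<in> oscillating"
    proof (rule ccontr)
      assume "x \<notin> oscillating"
      then obtain D where D: "(F has_real_derivative D) (at x)" "\<And>c. c < D \<Longrightarrow> x \<in> steep F c"
        using derivative_off_oscillating by blast
      then have "x \<in> steep F c'" using d[of x D] x c' by auto
      with x show False by auto
    qed
  qed
  then have null: "{p<..<q} - ?S \<in> null_sets lborel"
    by (rule null_sets_subset[OF oscillating_null, rotated]) auto
  have "ennreal (q - p) = emeasure lborel {p<..<q}" using pq by simp
  also have "\<dots> = emeasure lborel (?S \<union> ({p<..<q} - ?S))" by (rule arg_cong) blast
  also have "\<dots> = emeasure lborel ?S"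
    using null by (intro emeasure_Un_null_set) auto
  finally have "ennreal c' * ennreal (q - p) \<le> emeasure (interval_measure F) ?S"
    using steep_measure_ge[of ?S c'] by simp
  also have "\<dots> \<le> emeasure (interval_measure F) {p<..<q}" by (intro emeasure_mono) auto
  also have "\<dots> = ennreal (F q - F p)" using pq by (intro emeasure_Ioo) simp
  finally have "ennreal (c' * (q - p)) \<le> ennreal (F q - F p)"
    using pq by (simp add: ennreal_mult'')
  then have "c' * (q - p) \<le> F q - F p"
    using mono[of p q] pq by (subst (asm) ennreal_le_iff) auto
  then show "c * (q - p) \<le> F q - F p + e"
    using pq by (simp add: c'_def left_diff_distrib)
qed

end

text \<open>A mean value inequality that tests the derivative only where it exists.\<close>

lemma lipschitz_slope_ge:
  fixes f :: "real \<Rightarrow> real"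
  assumes L: "L-lipschitz_on UNIV f" and pq: "p \<le> q"
    and d: "\<And>s D. p < s \<Longrightarrow> s < q \<Longrightarrow> (f has_real_derivative D) (at s) \<Longrightarrow> c \<le> D"
  shows "c * (q - p) \<le> f q - f p"
proof (cases "p < q")
  case True
  define K where "K = L + 1"
  have K: "K > 0" using lipschitz_on_nonneg[OF L] by (simp add: K_def)
  define F where "F x = (f x + K * x) / (2 * K)" for x
  have lip: "\<bar>f s - f t\<bar> \<le> K * (s - t)" if "t \<le> s" for s t
    using lipschitz_onD[OF L, of s t] that by (simp add: dist_real_def K_def algebra_simps)
  interpret unit_slope F
  proof
    fix s t :: real assume "s \<le> t"
    have "F t - F s = (f t - f s + K * (t - s)) / (2 * K)"
      by (simp add: F_def diff_divide_distrib[symmetric] algebra_simps)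
    moreover have "0 \<le> (f t - f s + K * (t - s)) / (2 * K)" "(f t - f s + K * (t - s)) / (2 * K) \<le> t - s"
      using lip[OF \<open>s \<le> t\<close>] K by (auto simp: pos_divide_le_eq abs_le_iff)
    ultimately show "F s \<le> F t" "F t - F s \<le> t - s" by linarith+
  qed
  have "(c + K) / (2 * K) * (q - p) \<le> F q - F p"
  proof (rule slope_ge[OF True])
    fix s D assume s: "p < s" "s < q" "(F has_real_derivative D) (at s)"
    have "((\<lambda>x. 2 * K * F x - K * x) has_real_derivative 2 * K * D - K) (at s)"
      by (auto intro!: derivative_eq_intros s)
    moreover have "(\<lambda>x. 2 * K * F x - K * x) = f" using K by (auto simp: F_def)
    ultimately have "c \<le> 2 * K * D - K" using d[OF s(1,2)] by simp
    then show "(c + K) / (2 * K) \<le> D" using K by (simp add: field_simps)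
  qed
  then have "(c + K) * (q - p) / (2 * K) \<le> (f q + K * q - (f p + K * p)) / (2 * K)"
    by (simp add: F_def diff_divide_distrib)
  then have "(c + K) * (q - p) \<le> f q + K * q - (f p + K * p)"
    using K by (simp add: divide_le_cancel)
  then show ?thesis by (simp add: algebra_simps)
qed (use pq in simp)

section \<open>Limiting gradients of an expected loss\<close>

text \<open>Along a direction \<open>p\<close>, a limit of gradients is a limit of difference quotients with base points
  tending to \<open>x\<close> and step lengths tending to zero. No differentiation under the integral sign is
  needed to pass from an expected loss to its integrand.\<close>

lemma line_quotients_to_limiting_gradient:
  fixes f :: "'a::euclidean_space \<Rightarrow> real"
  assumes G: "\<And>k::nat. GDERIV f (y k) :> G k" "G \<longlonglongrightarrow> \<xi>"
  obtains t where "\<And>k. 0 < t k" "\<And>k. t k < 1 / real (Suc k)"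
    "(\<lambda>k. (f (y k + t k *\<^sub>R p) - f (y k)) / t k) \<longlonglongrightarrow> \<xi> \<bullet> p"
proof -
  have "\<exists>t>0. t < 1 / real (Suc k) \<and> \<bar>(f (y k + t *\<^sub>R p) - f (y k)) / t - G k \<bullet> p\<bar> < 1 / real (Suc k)" for k
  proof -
    have "((\<lambda>s. y k + s *\<^sub>R p) has_derivative (\<lambda>s. s *\<^sub>R p)) (at 0)"
      by (auto intro!: derivative_eq_intros)
    moreover have "(f has_derivative (\<lambda>h. h \<bullet> G k)) (at (y k + 0 *\<^sub>R p))"
      using G(1)[of k] by (simp add: gderiv_def)
    ultimately have "((\<lambda>s. f (y k + s *\<^sub>R p)) has_derivative (\<lambda>s. (s *\<^sub>R p) \<bullet> G k)) (at 0)"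
      by (rule has_derivative_compose)
    then have "((\<lambda>s. f (y k + s *\<^sub>R p)) has_real_derivative G k \<bullet> p) (at 0)"
      unfolding has_field_derivative_def
      by (rule has_derivative_eq_rhs) (simp add: fun_eq_iff inner_commute)
    then have "((\<lambda>t. (f (y k + t *\<^sub>R p) - f (y k)) / t) \<longlongrightarrow> G k \<bullet> p) (at_right 0)"
      unfolding DERIV_def by (auto intro: tendsto_mono[OF at_le])
    then have "\<forall>\<^sub>F t in at_right 0. \<bar>(f (y k + t *\<^sub>R p) - f (y k)) / t - G k \<bullet> p\<bar> < 1 / real (Suc k)"
      by (auto simp: tendsto_iff dist_real_def)
    moreover have "\<forall>\<^sub>F t in at_right 0. t \<in> {0<..<1 / real (Suc k)}"
      by (rule eventually_at_right_real) simp
    ultimately have "\<forall>\<^sub>F t in at_right 0. t \<in> {0<..<1 / real (Suc k)} \<and>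
        \<bar>(f (y k + t *\<^sub>R p) - f (y k)) / t - G k \<bullet> p\<bar> < 1 / real (Suc k)"
      by eventually_elim simp
    from eventually_happens'[OF _ this] show ?thesis by auto
  qed
  then obtain t where t: "\<And>k. 0 < t k" "\<And>k. t k < 1 / real (Suc k)"
    "\<And>k. \<bar>(f (y k + t k *\<^sub>R p) - f (y k)) / t k - G k \<bullet> p\<bar> < 1 / real (Suc k)"
    by metis
  have "(\<lambda>k. (f (y k + t k *\<^sub>R p) - f (y k)) / t k - G k \<bullet> p) \<longlonglongrightarrow> 0"
    by (rule Lim_null_comparison[OF _ LIMSEQ_inverse_real_of_nat])
      (use t(3) in \<open>auto simp: inverse_eq_divide less_imp_le\<close>)
  moreover have "(\<lambda>k. G k \<bullet> p) \<longlonglongrightarrow> \<xi> \<bullet> p" using G(2) by (intro tendsto_intros)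
  ultimately have "(\<lambda>k. (f (y k + t k *\<^sub>R p) - f (y k)) / t k) \<longlonglongrightarrow> \<xi> \<bullet> p"
    using tendsto_add by fastforce
  with t(1,2) show thesis by (rule that)
qed

text \<open>A probability distribution whose one-dimensional marginals have fourth moment at most \<open>B\<close>.\<close>

locale fourth_moments = prob_space D for D :: "(real^'d) measure" +
  fixes B :: real
  assumes sets_D [measurable_cong]: "sets D = sets borel"
    and B_pos: "0 < B"
    and fourth_moment: "\<And>\<rho>. norm \<rho> = 1 \<Longrightarrow>
      integrable D (\<lambda>z. (\<rho> \<bullet> z) ^ 4) \<and> (\<integral>z. (\<rho> \<bullet> z) ^ 4 \<partial>D) \<le> B"
begin

lemma moment22_unit:
  assumes "norm p = 1" "norm q = 1"
  shows "integrable D (\<lambda>z. (p \<bullet> z)\<^sup>2 * (q \<bullet> z)\<^sup>2)"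
    and "(\<integral>z. (p \<bullet> z)\<^sup>2 * (q \<bullet> z)\<^sup>2 \<partial>D) \<le> B"
proof -
  let ?g = "\<lambda>z. ((p \<bullet> z) ^ 4 + (q \<bullet> z) ^ 4) / 2"
  have le: "(p \<bullet> z)\<^sup>2 * (q \<bullet> z)\<^sup>2 \<le> ?g z" for z
  proof -
    have "0 \<le> ((p \<bullet> z)\<^sup>2 - (q \<bullet> z)\<^sup>2)\<^sup>2" by simp
    then show ?thesis by (simp add: power2_diff power_mult[symmetric])
  qed
  have g: "integrable D ?g" using fourth_moment[OF assms(1)] fourth_moment[OF assms(2)] by simp
  show i: "integrable D (\<lambda>z. (p \<bullet> z)\<^sup>2 * (q \<bullet> z)\<^sup>2)"
    by (rule Bochner_Integration.integrable_bound[OF g]) (use le in \<open>auto simp: abs_mult intro!: order_trans[OF le]\<close>)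
  have "(\<integral>z. (p \<bullet> z)\<^sup>2 * (q \<bullet> z)\<^sup>2 \<partial>D) \<le> (\<integral>z. ?g z \<partial>D)"
    by (rule integral_mono[OF i g le])
  also have "\<dots> \<le> B" using fourth_moment[OF assms(1)] fourth_moment[OF assms(2)] by simp
  finally show "(\<integral>z. (p \<bullet> z)\<^sup>2 * (q \<bullet> z)\<^sup>2 \<partial>D) \<le> B" .
qed

lemma moment22:
  shows "integrable D (\<lambda>z. (p \<bullet> z)\<^sup>2 * (q \<bullet> z)\<^sup>2)"
    and "(\<integral>z. (p \<bullet> z)\<^sup>2 * (q \<bullet> z)\<^sup>2 \<partial>D) \<le> B * (norm p)\<^sup>2 * (norm q)\<^sup>2"
proof -
  have "integrable D (\<lambda>z. (p \<bullet> z)\<^sup>2 * (q \<bullet> z)\<^sup>2) \<and>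
    (\<integral>z. (p \<bullet> z)\<^sup>2 * (q \<bullet> z)\<^sup>2 \<partial>D) \<le> B * (norm p)\<^sup>2 * (norm q)\<^sup>2"
  proof (cases "p = 0 \<or> q = 0")
    case False
    let ?c = "(norm p)\<^sup>2 * (norm q)\<^sup>2"
    have eq: "(\<lambda>z. (p \<bullet> z)\<^sup>2 * (q \<bullet> z)\<^sup>2) = (\<lambda>z. ?c * ((sgn p \<bullet> z)\<^sup>2 * (sgn q \<bullet> z)\<^sup>2))"
      using False by (auto simp: sgn_div_norm power_mult_distrib field_simps)
    have u: "norm (sgn p) = 1" "norm (sgn q) = 1" using False by (auto simp: norm_sgn)
    show ?thesis
      unfolding eq using moment22_unit[OF u] mult_left_mono[OF moment22_unit(2)[OF u], of ?c]
      by (simp add: ac_simps)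
  qed auto
  then show "integrable D (\<lambda>z. (p \<bullet> z)\<^sup>2 * (q \<bullet> z)\<^sup>2)"
    and "(\<integral>z. (p \<bullet> z)\<^sup>2 * (q \<bullet> z)\<^sup>2 \<partial>D) \<le> B * (norm p)\<^sup>2 * (norm q)\<^sup>2" by auto
qed

lemma moment11_unit:
  assumes "norm p = 1" "norm q = 1"
  shows "integrable D (\<lambda>z. \<bar>p \<bullet> z\<bar> * \<bar>q \<bullet> z\<bar>)"
    and "(\<integral>z. \<bar>p \<bullet> z\<bar> * \<bar>q \<bullet> z\<bar> \<partial>D) \<le> sqrt B"
proof -
  let ?g = "\<lambda>z. sqrt B / 2 + ((p \<bullet> z)\<^sup>2 * (q \<bullet> z)\<^sup>2) / (2 * sqrt B)"
  have sB: "0 < sqrt B" "sqrt B * sqrt B = B" using B_pos by auto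
  have le: "\<bar>p \<bullet> z\<bar> * \<bar>q \<bullet> z\<bar> \<le> ?g z" for z
  proof -
    have "0 \<le> (sqrt B - \<bar>p \<bullet> z\<bar> * \<bar>q \<bullet> z\<bar>)\<^sup>2" by simp
    then have "2 * sqrt B * (\<bar>p \<bullet> z\<bar> * \<bar>q \<bullet> z\<bar>) \<le> sqrt B * sqrt B + (p \<bullet> z)\<^sup>2 * (q \<bullet> z)\<^sup>2"
      by (simp add: power2_diff power_mult_distrib power2_eq_square[of "sqrt B"])
    then show ?thesis using sB by (simp add: field_simps)
  qed
  have g: "integrable D ?g" using moment22 by simp
  show i: "integrable D (\<lambda>z. \<bar>p \<bullet> z\<bar> * \<bar>q \<bullet> z\<bar>)"
    by (rule Bochner_Integration.integrable_bound[OF g]) (auto simp: abs_mult intro!: order_trans[OF le])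
  have "(\<integral>z. \<bar>p \<bullet> z\<bar> * \<bar>q \<bullet> z\<bar> \<partial>D) \<le> (\<integral>z. ?g z \<partial>D)"
    by (rule integral_mono[OF i g le])
  also have "\<dots> = sqrt B / 2 + (\<integral>z. (p \<bullet> z)\<^sup>2 * (q \<bullet> z)\<^sup>2 \<partial>D) / (2 * sqrt B)"
    using moment22(1)[of p q] by (simp add: prob_space)
  also have "\<dots> \<le> sqrt B / 2 + B / (2 * sqrt B)"
    using moment22_unit(2)[OF assms] sB by (intro add_left_mono divide_right_mono) auto
  also have "\<dots> = sqrt B" using sB by (simp add: field_simps)
  finally show "(\<integral>z. \<bar>p \<bullet> z\<bar> * \<bar>q \<bullet> z\<bar> \<partial>D) \<le> sqrt B" .
qed

lemma moment11:
  shows "integrable D (\<lambda>z. \<bar>p \<bullet> z\<bar> * \<bar>q \<bullet> z\<bar>)"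
    and "(\<integral>z. \<bar>p \<bullet> z\<bar> * \<bar>q \<bullet> z\<bar> \<partial>D) \<le> sqrt B * norm p * norm q"
proof -
  have "integrable D (\<lambda>z. \<bar>p \<bullet> z\<bar> * \<bar>q \<bullet> z\<bar>) \<and>
    (\<integral>z. \<bar>p \<bullet> z\<bar> * \<bar>q \<bullet> z\<bar> \<partial>D) \<le> sqrt B * norm p * norm q"
  proof (cases "p = 0 \<or> q = 0")
    case False
    let ?c = "norm p * norm q"
    have eq: "(\<lambda>z. \<bar>p \<bullet> z\<bar> * \<bar>q \<bullet> z\<bar>) = (\<lambda>z. ?c * (\<bar>sgn p \<bullet> z\<bar> * \<bar>sgn q \<bullet> z\<bar>))"
      using False by (auto simp: sgn_div_norm abs_mult field_simps)
    have u: "norm (sgn p) = 1" "norm (sgn q) = 1" using False by (auto simp: norm_sgn)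
    show ?thesis
      unfolding eq using moment11_unit[OF u] mult_left_mono[OF moment11_unit(2)[OF u], of ?c]
      by (simp add: ac_simps)
  qed auto
  then show "integrable D (\<lambda>z. \<bar>p \<bullet> z\<bar> * \<bar>q \<bullet> z\<bar>)"
    and "(\<integral>z. \<bar>p \<bullet> z\<bar> * \<bar>q \<bullet> z\<bar> \<partial>D) \<le> sqrt B * norm p * norm q" by auto
qed

lemma integrable_norm_square: "integrable D (\<lambda>z. (norm z)\<^sup>2)"
proof -
  have "(norm z)\<^sup>2 = (\<Sum>b\<in>Basis. \<bar>b \<bullet> z\<bar> * \<bar>b \<bullet> z\<bar>)" for z :: "real^'d"
    by (subst power2_norm_eq_inner, subst euclidean_inner) (simp add: inner_commute)
  then show ?thesis using moment11(1) by (simp del: abs_mult_self_eq)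
qed

end

text \<open>The loss \<open>\<Phi> u w\<close> of a single sample, as a function of the prediction input \<open>u = x \<bullet> z\<close> and of the
  target input \<open>w = xs \<bullet> z\<close>. Its increments in \<open>u\<close> factor as \<open>r * s\<close> times the step, where \<open>r\<close> is close
  to the residual \<open>\<psi> u w\<close> and \<open>s\<close> stands for a slope of the activation: \<open>0 \<le> s \<le> l\<close>, and
  \<open>m \<le> s\<close> when both inputs are positive. The activation need not be differentiable, so \<open>s\<close> need not
  converge as the step shrinks. The residual is \<open>k\<close>-Lipschitz in \<open>u\<close>, and quadratic growth of \<open>\<Phi>\<close>
  ensures that its expectation exists under second moments.\<close>

locale sample_loss =
  fixes \<Phi> \<psi> :: "real \<Rightarrow> real \<Rightarrow> real" and k l m C :: real
  assumes cont: "continuous_on UNIV (\<lambda>v :: real \<times> real. \<Phi> (fst v) (snd v))"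
    and growth: "\<And>u w. \<bar>\<Phi> u w\<bar> \<le> C * (u\<^sup>2 + w\<^sup>2)"
    and residual_lipschitz: "\<And>u u' w. \<bar>\<psi> u w - \<psi> u' w\<bar> \<le> k * \<bar>u - u'\<bar>"
    and residual_diag: "\<And>w. \<psi> w w = 0"
    and increment: "\<And>u u' w. \<exists>r s. \<Phi> u' w - \<Phi> u w = r * s * (u' - u) \<and>
      \<bar>r - \<psi> u w\<bar> \<le> k * \<bar>u' - u\<bar> \<and> 0 \<le> s \<and> s \<le> l \<and> (0 < u \<and> 0 < u' \<longrightarrow> m \<le> s)"
begin

lemma residual_le: "\<bar>\<psi> u w\<bar> \<le> k * \<bar>u - w\<bar>"
  using residual_lipschitz[of u w w] by (simp add: residual_diag)

lemma k_nonneg: "0 \<le> k"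
  using residual_lipschitz[of 1 0 0] by (auto intro: order_trans[OF abs_ge_zero])

lemma l_nonneg: "0 \<le> l"
  using increment[of 0 0 0] by force

end

context fourth_moments
begin

text \<open>If \<open>H\<close> bounds \<open>s * \<psi> * (p \<bullet> z)\<close> for every admissible slope \<open>s\<close> at \<open>x\<close>, then its expectation bounds
  the \<open>p\<close>-component of every limiting gradient at \<open>x\<close>.\<close>

lemma limiting_gradient_le:
  fixes w x p :: "real^'d"
  assumes loss: "sample_loss \<Phi> \<psi> k l m C"
    and y: "y \<longlonglongrightarrow> x"
    and G: "\<And>n::nat. GDERIV (\<lambda>y. \<integral>z. \<Phi> (y \<bullet> z) (w \<bullet> z) \<partial>D) (y n) :> G n" "G \<longlonglongrightarrow> \<xi>"
    and H: "integrable D H"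
      "\<And>z s. 0 \<le> s \<Longrightarrow> s \<le> l \<Longrightarrow> (0 < x \<bullet> z \<Longrightarrow> m \<le> s) \<Longrightarrow> s * \<psi> (x \<bullet> z) (w \<bullet> z) * (p \<bullet> z) \<le> H z"
  shows "\<xi> \<bullet> p \<le> (\<integral>z. H z \<partial>D)"
proof -
  interpret sample_loss \<Phi> \<psi> k l m C by (rule loss)
  let ?f = "\<lambda>y. \<integral>z. \<Phi> (y \<bullet> z) (w \<bullet> z) \<partial>D"
  obtain t where t: "\<And>n. 0 < t n" "\<And>n. t n < 1 / real (Suc n)"
    and lim: "(\<lambda>n. (?f (y n + t n *\<^sub>R p) - ?f (y n)) / t n) \<longlonglongrightarrow> \<xi> \<bullet> p"
    using line_quotients_to_limiting_gradient[OF G] by blast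
  have t1: "t n \<le> 1" for n
    using t(2)[of n] by (rule less_imp_le[OF less_le_trans]) simp
  have t0: "t \<longlonglongrightarrow> 0"
    by (rule tendsto_sandwich[OF _ _ tendsto_const LIMSEQ_inverse_real_of_nat])
      (use t in \<open>auto simp: inverse_eq_divide less_imp_le\<close>)
  have meas [measurable]: "(\<lambda>z. \<Phi> (v \<bullet> z) (w \<bullet> z)) \<in> borel_measurable borel" for v
  proof (rule borel_measurable_continuous_onI)
    show "continuous_on UNIV (\<lambda>z. \<Phi> (v \<bullet> z) (w \<bullet> z))"
      using continuous_on_compose2[OF cont, of UNIV "\<lambda>z. (v \<bullet> z, w \<bullet> z)"]
      by (simp add: continuous_intros)
  qed
  have int: "integrable D (\<lambda>z. \<Phi> (v \<bullet> z) (w \<bullet> z))" for v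
  proof (rule Bochner_Integration.integrable_bound)
    show "integrable D (\<lambda>z. C * (\<bar>v \<bullet> z\<bar> * \<bar>v \<bullet> z\<bar> + \<bar>w \<bullet> z\<bar> * \<bar>w \<bullet> z\<bar>))"
      using moment11(1) by (intro integrable_mult_right Bochner_Integration.integrable_add)
    show "AE z in D. norm (\<Phi> (v \<bullet> z) (w \<bullet> z)) \<le> norm (C * (\<bar>v \<bullet> z\<bar> * \<bar>v \<bullet> z\<bar> + \<bar>w \<bullet> z\<bar> * \<bar>w \<bullet> z\<bar>))"
      using growth by (auto simp: power2_eq_square intro: order_trans[OF _ abs_ge_self])
  qed measurable
  define Q where "Q n z = (\<Phi> ((y n + t n *\<^sub>R p) \<bullet> z) (w \<bullet> z) - \<Phi> (y n \<bullet> z) (w \<bullet> z)) / t n" for n z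
  have Q_meas [measurable]: "Q n \<in> borel_measurable borel" for n
    unfolding Q_def by measurable
  have Q_int: "integrable D (Q n)" for n
    unfolding Q_def using int by simp
  have Q_eq: "\<exists>r s. Q n z = r * s * (p \<bullet> z) \<and> \<bar>r - \<psi> (y n \<bullet> z) (w \<bullet> z)\<bar> \<le> k * (t n * \<bar>p \<bullet> z\<bar>)
      \<and> 0 \<le> s \<and> s \<le> l \<and> (0 < y n \<bullet> z \<and> 0 < (y n + t n *\<^sub>R p) \<bullet> z \<longrightarrow> m \<le> s)" for n z
  proof -
    from increment[of "(y n + t n *\<^sub>R p) \<bullet> z" "w \<bullet> z" "y n \<bullet> z"]
    obtain r s where "\<Phi> ((y n + t n *\<^sub>R p) \<bullet> z) (w \<bullet> z) - \<Phi> (y n \<bullet> z) (w \<bullet> z)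
        = r * s * ((y n + t n *\<^sub>R p) \<bullet> z - y n \<bullet> z)"
      "\<bar>r - \<psi> (y n \<bullet> z) (w \<bullet> z)\<bar> \<le> k * \<bar>(y n + t n *\<^sub>R p) \<bullet> z - y n \<bullet> z\<bar>"
      "0 \<le> s" "s \<le> l" "0 < y n \<bullet> z \<and> 0 < (y n + t n *\<^sub>R p) \<bullet> z \<longrightarrow> m \<le> s"
      by blast
    then show ?thesis using t(1)[of n]
      by (intro exI[of _ r] exI[of _ s]) (auto simp: Q_def inner_add_left abs_mult)
  qed
  have "bounded (range y)" using y convergent_imp_bounded by auto
  then obtain R where R: "\<And>n. norm (y n) \<le> R" by (auto simp: bounded_iff)
  define K where "K = k * (R + norm w + norm p) * l * norm p"
  have Q_bound: "\<bar>Q n z\<bar> \<le> K * (norm z)\<^sup>2" for n z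
  proof -
    obtain r s where rs: "Q n z = r * s * (p \<bullet> z)" "\<bar>r - \<psi> (y n \<bullet> z) (w \<bullet> z)\<bar> \<le> k * (t n * \<bar>p \<bullet> z\<bar>)"
      "0 \<le> s" "s \<le> l" using Q_eq by blast
    have cs: "\<bar>v \<bullet> z\<bar> \<le> norm v * norm z" for v by (rule Cauchy_Schwarz_ineq2)
    have "\<bar>r\<bar> \<le> k * \<bar>(y n - w) \<bullet> z\<bar> + k * (t n * \<bar>p \<bullet> z\<bar>)"
      using residual_le[of "y n \<bullet> z" "w \<bullet> z"] rs(2) by (simp add: inner_diff_left)
    also have "\<dots> \<le> k * ((R + norm w) * norm z) + k * (norm p * norm z)"
    proof (intro add_mono mult_left_mono k_nonneg)
      have "\<bar>(y n - w) \<bullet> z\<bar> \<le> norm (y n - w) * norm z" by (rule cs)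
      also have "\<dots> \<le> (R + norm w) * norm z"
        using norm_triangle_ineq4[of "y n" w] R[of n] by (intro mult_right_mono) auto
      finally show "\<bar>(y n - w) \<bullet> z\<bar> \<le> (R + norm w) * norm z" .
      show "t n * \<bar>p \<bullet> z\<bar> \<le> norm p * norm z"
        using mult_right_mono[OF t1[of n], of "\<bar>p \<bullet> z\<bar>"] cs[of p] by simp
    qed
    finally have r: "\<bar>r\<bar> \<le> k * (R + norm w + norm p) * norm z" by (simp add: algebra_simps)
    have "\<bar>Q n z\<bar> = \<bar>r\<bar> * s * \<bar>p \<bullet> z\<bar>" using rs by (simp add: abs_mult)
    also have "\<dots> \<le> (k * (R + norm w + norm p) * norm z) * l * (norm p * norm z)"
      using r rs cs[of p] l_nonneg order_trans[OF abs_ge_zero r] by (intro mult_mono) auto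
    finally show ?thesis by (simp add: K_def power2_eq_square algebra_simps)
  qed
  \<comment> \<open>The quotients \<open>Q n\<close> need not converge, but their maximum with \<open>H\<close> tends to \<open>H\<close>, and dominated
    convergence applies to it.\<close>
  let ?M = "\<lambda>n z. max (Q n z) (H z)"
  have H_meas [measurable]: "H \<in> borel_measurable D" using H(1) by simp
  have M_lim: "(\<lambda>n. ?M n z) \<longlonglongrightarrow> H z" for z
  proof -
    define e where "e n = l * (k * (t n * \<bar>p \<bullet> z\<bar>) + k * \<bar>y n \<bullet> z - x \<bullet> z\<bar>) * \<bar>p \<bullet> z\<bar>" for n
    have y_lim: "(\<lambda>n. y n \<bullet> z) \<longlonglongrightarrow> x \<bullet> z" using y by (intro tendsto_intros)
    have e_nonneg: "0 \<le> e n" for n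
      unfolding e_def using k_nonneg l_nonneg t(1)[of n] by simp
    have e_lim: "e \<longlonglongrightarrow> 0"
    proof -
      have "e \<longlonglongrightarrow> l * (k * (0 * \<bar>p \<bullet> z\<bar>) + k * \<bar>x \<bullet> z - x \<bullet> z\<bar>) * \<bar>p \<bullet> z\<bar>"
        unfolding e_def by (intro tendsto_intros t0 y_lim)
      then show ?thesis by simp
    qed
    have "\<forall>\<^sub>F n in sequentially. 0 < x \<bullet> z \<longrightarrow> 0 < y n \<bullet> z \<and> 0 < (y n + t n *\<^sub>R p) \<bullet> z"
    proof (cases "0 < x \<bullet> z")
      case True
      have "(\<lambda>n. (y n + t n *\<^sub>R p) \<bullet> z) \<longlonglongrightarrow> (x + 0 *\<^sub>R p) \<bullet> z"
        by (intro tendsto_intros y t0)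
      then have "\<forall>\<^sub>F n in sequentially. 0 < (y n + t n *\<^sub>R p) \<bullet> z"
        using True by (auto elim: order_tendstoD)
      moreover have "\<forall>\<^sub>F n in sequentially. 0 < y n \<bullet> z"
        using True y_lim by (auto elim: order_tendstoD)
      ultimately show ?thesis by eventually_elim simp
    qed simp
    then have upper: "\<forall>\<^sub>F n in sequentially. ?M n z \<le> H z + e n"
    proof eventually_elim
      case (elim n)
      obtain r s where rs: "Q n z = r * s * (p \<bullet> z)" "\<bar>r - \<psi> (y n \<bullet> z) (w \<bullet> z)\<bar> \<le> k * (t n * \<bar>p \<bullet> z\<bar>)"
        "0 \<le> s" "s \<le> l" "0 < y n \<bullet> z \<and> 0 < (y n + t n *\<^sub>R p) \<bullet> z \<longrightarrow> m \<le> s" using Q_eq by blast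
      have "\<bar>r - \<psi> (x \<bullet> z) (w \<bullet> z)\<bar> \<le> k * (t n * \<bar>p \<bullet> z\<bar>) + k * \<bar>y n \<bullet> z - x \<bullet> z\<bar>"
        using rs(2) residual_lipschitz[of "y n \<bullet> z" "w \<bullet> z" "x \<bullet> z"] by linarith
      then have "s * \<bar>r - \<psi> (x \<bullet> z) (w \<bullet> z)\<bar> * \<bar>p \<bullet> z\<bar> \<le> e n"
        unfolding e_def using rs l_nonneg by (intro mult_right_mono mult_mono) auto
      moreover have "Q n z - s * \<psi> (x \<bullet> z) (w \<bullet> z) * (p \<bullet> z) = s * (r - \<psi> (x \<bullet> z) (w \<bullet> z)) * (p \<bullet> z)"
        by (simp add: rs(1) algebra_simps)
      moreover have "s * (r - \<psi> (x \<bullet> z) (w \<bullet> z)) * (p \<bullet> z) \<le> s * \<bar>r - \<psi> (x \<bullet> z) (w \<bullet> z)\<bar> * \<bar>p \<bullet> z\<bar>"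
        using rs(3) by (metis abs_ge_self abs_mult abs_of_nonneg)
      moreover have "s * \<psi> (x \<bullet> z) (w \<bullet> z) * (p \<bullet> z) \<le> H z"
        using rs elim by (intro H(2)) auto
      ultimately show ?case using e_nonneg[of n] by linarith
    qed
    have "(\<lambda>n. H z + e n) \<longlonglongrightarrow> H z" using tendsto_add[OF tendsto_const e_lim] by simp
    then show ?thesis
      by (rule tendsto_sandwich[OF always_eventually upper tendsto_const, rotated]) simp
  qed
  have "(\<lambda>n. \<integral>z. ?M n z \<partial>D) \<longlonglongrightarrow> (\<integral>z. H z \<partial>D)"
  proof (rule integral_dominated_convergence)
    show "integrable D (\<lambda>z. K * (norm z)\<^sup>2 + \<bar>H z\<bar>)"
      using integrable_norm_square H(1) by simp
    show "AE z in D. norm (?M n z) \<le> K * (norm z)\<^sup>2 + \<bar>H z\<bar>" for n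
    proof (rule AE_I2)
      fix z show "norm (?M n z) \<le> K * (norm z)\<^sup>2 + \<bar>H z\<bar>" using Q_bound[of n z] by auto
    qed
  qed (use M_lim in auto)
  moreover have "(?f (y n + t n *\<^sub>R p) - ?f (y n)) / t n \<le> (\<integral>z. ?M n z \<partial>D)" for n
  proof -
    have "(?f (y n + t n *\<^sub>R p) - ?f (y n)) / t n = (\<integral>z. Q n z \<partial>D)"
      unfolding Q_def using int by simp
    also have "\<dots> \<le> (\<integral>z. ?M n z \<partial>D)"
      using Q_int H(1) by (intro integral_mono integrable_max) auto
    finally show ?thesis .
  qed
  ultimately show ?thesis using lim by (intro LIMSEQ_le) auto
qed

end

section \<open>The descent estimate\<close>

lemma outer_mult_vec: "outer x y *v v = (y \<bullet> v) *\<^sub>R x"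
  by (vector outer_def matrix_vector_mult_def inner_vec_def) (simp add: sum_distrib_left ac_simps)

lemma norm_outer: "norm (outer x y) = norm x * norm y"
proof -
  have "outer x y $ i = (x $ i) *\<^sub>R y" for i
    by (simp add: outer_def vec_eq_iff)
  then show ?thesis
    by (simp add: norm_vec_def[of "outer x y"] L2_set_left_distrib norm_vec_def[of x])
qed

lemma continuous_outer: "continuous_on UNIV (\<lambda>z :: real^'d. outer z z)"
  unfolding outer_def by (intro continuous_intros)

lemma (in fourth_moments) loewner_moment:
  assumes "loewner_ge (\<integral>z. indicat_real {z. xs \<bullet> z \<ge> \<gamma>} z *\<^sub>R outer z z \<partial>D) (lam *\<^sub>R mat 1)"
  shows "lam * (norm v)\<^sup>2 \<le> (\<integral>z. indicat_real {z. xs \<bullet> z \<ge> \<gamma>} z * (v \<bullet> z)\<^sup>2 \<partial>D)"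
proof -
  let ?F = "\<lambda>z. indicat_real {z. xs \<bullet> z \<ge> \<gamma>} z *\<^sub>R outer z z"
  let ?T = "\<lambda>A :: real^'d^'d. v \<bullet> (A *v v)"
  have [measurable]: "(\<lambda>z :: real^'d. outer z z) \<in> borel_measurable borel"
    using continuous_outer by (rule borel_measurable_continuous_onI)
  have int: "integrable D ?F"
    by (rule Bochner_Integration.integrable_bound[OF integrable_norm_square])
      (auto simp: norm_outer power2_eq_square indicator_def)
  have "linear ?T"
    by (rule linearI) (simp_all add: matrix_vector_mult_add_rdistrib inner_add_right
        flip: scaleR_matrix_vector_assoc)
  then have T: "bounded_linear ?T" by (simp add: linear_conv_bounded_linear)
  have "(\<integral>z. ?T (?F z) \<partial>D) = ?T (\<integral>z. ?F z \<partial>D)"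
    by (rule integral_bounded_linear[OF T int])
  moreover have "?T (?F z) = indicat_real {z. xs \<bullet> z \<ge> \<gamma>} z * (v \<bullet> z)\<^sup>2" for z
    by (simp add: outer_mult_vec power2_eq_square inner_commute flip: scaleR_matrix_vector_assoc)
  moreover have "lam * (norm v)\<^sup>2 \<le> ?T (\<integral>z. ?F z \<partial>D)"
    using assms unfolding loewner_ge_def
    by (simp add: matrix_vector_mult_diff_rdistrib inner_diff_right power2_norm_eq_inner
        flip: scaleR_matrix_vector_assoc)
  ultimately show ?thesis by simp
qed

text \<open>The integrated form of the derivative conditions: nondecreasing, slopes at most \<open>b\<close>, and slopes
  at least \<open>a\<close> on the nonnegative half-line.\<close>

locale activation =
  fixes \<sigma> :: "real \<Rightarrow> real" and a b :: real
  assumes a_pos: "0 < a" and a_le_b: "a \<le> b"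
    and nondecreasing: "\<And>s t. s \<le> t \<Longrightarrow> \<sigma> s \<le> \<sigma> t"
    and slope_le: "\<And>s t. s \<le> t \<Longrightarrow> \<sigma> t - \<sigma> s \<le> b * (t - s)"
    and slope_ge: "\<And>s t. 0 \<le> s \<Longrightarrow> s \<le> t \<Longrightarrow> a * (t - s) \<le> \<sigma> t - \<sigma> s"
begin

lemma b_pos: "0 < b" using a_pos a_le_b by simp

lemma lipschitz: "\<bar>\<sigma> s - \<sigma> t\<bar> \<le> b * \<bar>s - t\<bar>"
  using nondecreasing[of s t] nondecreasing[of t s] slope_le[of s t] slope_le[of t s]
  by (cases "s \<le> t") auto

lemma continuous: "continuous_on UNIV \<sigma>"
proof (rule lipschitz_on_continuous_on)
  show "b-lipschitz_on UNIV \<sigma>"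
    using lipschitz b_pos by (intro lipschitz_onI) (auto simp: dist_real_def)
qed

lemma secant:
  "\<exists>s. \<sigma> u' - \<sigma> u = s * (u' - u) \<and> 0 \<le> s \<and> s \<le> b \<and> (0 < u \<and> 0 < u' \<longrightarrow> a \<le> s)"
proof -
  have *: "0 \<le> (\<sigma> q - \<sigma> p) / (q - p) \<and> (\<sigma> q - \<sigma> p) / (q - p) \<le> b \<and>
      (0 < p \<longrightarrow> a \<le> (\<sigma> q - \<sigma> p) / (q - p))" if "p < q" for p q
    using that nondecreasing[of p q] slope_le[of p q] slope_ge[of p q]
    by (auto simp: pos_divide_le_eq pos_le_divide_eq)
  consider "u = u'" | "u < u'" | "u' < u" by linarith
  then show ?thesis
  proof cases
    case 1 then show ?thesis using b_pos a_le_b by (intro exI[of _ b]) auto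
  next
    case 2 then show ?thesis using *[of u u'] by (intro exI[of _ "(\<sigma> u' - \<sigma> u) / (u' - u)"]) auto
  next
    case 3
    have "(\<sigma> u' - \<sigma> u) / (u' - u) = (\<sigma> u - \<sigma> u') / (u - u')"
      by (metis minus_diff_eq minus_divide_divide)
    moreover have "\<sigma> u' - \<sigma> u = (\<sigma> u' - \<sigma> u) / (u' - u) * (u' - u)" using 3 by simp
    ultimately show ?thesis using 3 *[of u' u]
      by (intro exI[of _ "(\<sigma> u' - \<sigma> u) / (u' - u)"] conjI) auto
  qed
qed

end

text \<open>The derivative of the outer loss applied to \<open>\<sigma> u - \<sigma> w\<close>: the identity for the squared
  loss, clipping at \<open>\<alpha>\<close> for the Huber loss. The surrogate loss has no outer loss, but its residual
  is again \<open>\<sigma> u - \<sigma> w\<close>, so the identity serves there too.\<close>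

locale truncation =
  fixes g :: "real \<Rightarrow> real" and \<alpha> :: real
  assumes alpha_pos: "0 < \<alpha>"
    and g_mono: "\<And>s t. s \<le> t \<Longrightarrow> g s \<le> g t"
    and g_slope: "\<And>s t. s \<le> t \<Longrightarrow> g t - g s \<le> t - s"
    and g_id: "\<And>t. \<bar>t\<bar> \<le> \<alpha> \<Longrightarrow> g t = t"
begin

lemma g_lipschitz: "\<bar>g s - g t\<bar> \<le> \<bar>s - t\<bar>"
  using g_mono[of s t] g_mono[of t s] g_slope[of s t] g_slope[of t s]
  by (cases "s \<le> t") auto

lemma g_0: "g 0 = 0" using g_id[of 0] alpha_pos by simp

lemma g_abs_le: "\<bar>g t\<bar> \<le> \<bar>t\<bar>" using g_lipschitz[of t 0] by (simp add: g_0)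

end

locale truncated_activation = activation \<sigma> a b + truncation g \<alpha> for \<sigma> a b g \<alpha>
begin

text \<open>Here \<open>u = x \<bullet> z\<close>, \<open>w = xs \<bullet> z\<close>, \<open>c\<close> is the cosine of the angle, and \<open>y\<close> is the inner product of \<open>z\<close> with
  the projection of \<open>xs\<close> to the tangent space at \<open>x\<close>. Replacing \<open>\<sigma> w\<close> by \<open>\<sigma> (w / c)\<close> costs the first
  term on the right; afterwards the residual and \<open>y\<close> have opposite signs, as \<open>y / c = w / c - u\<close>. The
  remaining terms give the quadratic gain where \<open>w \<ge> \<gamma>\<close>. The three subtracted terms
  dominate it, in the manner of Markov's inequality, where \<open>u \<le> 0\<close> or one of the two residuals
  leaves the range on which \<open>g\<close> is the identity.\<close>

lemma pointwise_descent:
  fixes u w c s l m \<gamma> :: real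
  assumes c: "0 < c" "c \<le> 1" and s: "0 \<le> s" "s \<le> l" "0 < u \<Longrightarrow> m \<le> s"
    and m: "0 \<le> m" and \<gamma>: "0 < \<gamma>"
  defines "y \<equiv> w - c * u"
  shows "s * g (\<sigma> u - \<sigma> w) * y \<le> l * b * (1 / c - 1) * (\<bar>w\<bar> * \<bar>y\<bar>)
    - (m * a / c) * (of_bool (\<gamma> \<le> w) * y\<^sup>2 - y\<^sup>2 * y\<^sup>2 / \<gamma>\<^sup>2
        - y\<^sup>2 * (u - w)\<^sup>2 * (b / \<alpha>)\<^sup>2 - y\<^sup>2 * w\<^sup>2 * (b * (1 / c - 1) / \<alpha>)\<^sup>2)"
    (is "_ \<le> ?E - ?k * ?R")
proof -
  define A where "A = \<sigma> u - \<sigma> w"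
  define B where "B = \<sigma> (w / c) - \<sigma> w"
  have y: "y / c = w / c - u" using c by (simp add: y_def field_simps)
  have y_sign: "0 \<le> y \<longleftrightarrow> u \<le> w / c" using c by (auto simp: y_def field_simps)
  have k: "0 \<le> ?k" using m a_pos c by simp
  have neg: "(g A - g B) * y \<le> 0"
  proof (cases "0 \<le> y")
    case True
    then have "A \<le> B" using y_sign nondecreasing[of u "w / c"] by (simp add: A_def B_def)
    then show ?thesis using g_mono[of A B] True by (simp add: mult_le_0_iff)
  next
    case False
    then have "B \<le> A" using y_sign nondecreasing[of "w / c" u] by (simp add: A_def B_def)
    then show ?thesis using g_mono[of B A] False by (simp add: mult_le_0_iff)
  qed
  have c1: "0 \<le> 1 / c - 1" using c by simp
  have "\<bar>g B\<bar> \<le> \<bar>B\<bar>" by (rule g_abs_le)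
  also have "\<dots> \<le> b * \<bar>w / c - w\<bar>" unfolding B_def by (rule lipschitz)
  also have "w / c - w = (1 / c - 1) * w" by (simp add: algebra_simps)
  finally have "\<bar>g B\<bar> \<le> b * ((1 / c - 1) * \<bar>w\<bar>)" using c1 by (simp add: abs_mult)
  moreover have Bdiff: "\<bar>B\<bar> \<le> b * ((1 / c - 1) * \<bar>w\<bar>)"
    using lipschitz[of "w / c" w] c1 \<open>w / c - w = (1 / c - 1) * w\<close> by (simp add: B_def abs_mult)
  ultimately have "s * \<bar>g B\<bar> * \<bar>y\<bar> \<le> l * (b * ((1 / c - 1) * \<bar>w\<bar>)) * \<bar>y\<bar>"
    using s by (intro mult_right_mono mult_mono) auto
  moreover have "s * g B * y \<le> s * \<bar>g B\<bar> * \<bar>y\<bar>"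
    using s by (metis abs_ge_self abs_mult abs_of_nonneg)
  moreover have "s * g A * y = s * ((g A - g B) * y) + s * g B * y" by (simp add: algebra_simps)
  ultimately have base: "s * g A * y \<le> s * ((g A - g B) * y) + ?E"
    by (simp add: algebra_simps)
  have nn: "0 \<le> y\<^sup>2 * y\<^sup>2 / \<gamma>\<^sup>2" "0 \<le> y\<^sup>2 * (u - w)\<^sup>2 * (b / \<alpha>)\<^sup>2"
    "0 \<le> y\<^sup>2 * w\<^sup>2 * (b * (1 / c - 1) / \<alpha>)\<^sup>2" by simp_all
  have "s * ((g A - g B) * y) \<le> - (?k * ?R)"
  proof (cases "\<gamma> \<le> w \<and> 0 < u \<and> b * \<bar>u - w\<bar> \<le> \<alpha> \<and> b * (1 / c - 1) * \<bar>w\<bar> \<le> \<alpha>")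
    case True
    have "g A = A" using True lipschitz[of u w] by (intro g_id) (simp add: A_def)
    moreover have "g B = B" using True Bdiff by (intro g_id) (simp add: ac_simps)
    ultimately have "(g A - g B) * y = (\<sigma> u - \<sigma> (w / c)) * y" by (simp add: A_def B_def)
    also have "\<dots> \<le> - (a * (y / c)) * y"
    proof (cases "0 \<le> y")
      case y0: True
      then have "a * (y / c) \<le> \<sigma> (w / c) - \<sigma> u"
        using slope_ge[of u "w / c"] y y_sign True by simp
      with y0 show ?thesis by (intro mult_right_mono) auto
    next
      case y0: False
      then have "a * (u - w / c) \<le> \<sigma> u - \<sigma> (w / c)"
        using slope_ge[of "w / c" u] y_sign True \<gamma> c by simp
      moreover have "a * (u - w / c) = - (a * (y / c))" unfolding y by (simp add: algebra_simps)
      ultimately show ?thesis using y0 by (intro mult_right_mono_neg) auto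
    qed
    also have "\<dots> = - (a / c * y\<^sup>2)" by (simp add: power2_eq_square)
    finally have "s * ((g A - g B) * y) \<le> s * (- (a / c * y\<^sup>2))" using s by (intro mult_left_mono)
    also have "\<dots> \<le> m * (- (a / c * y\<^sup>2))"
      using s True a_pos c by (intro mult_right_mono_neg) auto
    also have "\<dots> = - (?k * y\<^sup>2)" by simp
    also have "\<dots> \<le> - (?k * ?R)"
    proof -
      have "?R \<le> y\<^sup>2" using conjunct1[OF True] nn by (simp only: of_bool_eq mult_1)
      from mult_left_mono[OF this k] show ?thesis by (rule le_imp_neg_le)
    qed
    finally show ?thesis .
  next
    case False
    have sq: "1 \<le> t\<^sup>2" if "1 \<le> \<bar>t\<bar>" for t :: real
      using power_mono[OF that, of 2] by simp
    have "?R \<le> 0"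
    proof (cases "\<gamma> \<le> w")
      case w: True
      consider "u \<le> 0" | "\<alpha> < b * \<bar>u - w\<bar>" | "\<alpha> < b * (1 / c - 1) * \<bar>w\<bar>"
        using False w by linarith
      then have "y\<^sup>2 * 1 \<le> y\<^sup>2 * y\<^sup>2 / \<gamma>\<^sup>2 \<or> y\<^sup>2 * 1 \<le> y\<^sup>2 * (u - w)\<^sup>2 * (b / \<alpha>)\<^sup>2
        \<or> y\<^sup>2 * 1 \<le> y\<^sup>2 * w\<^sup>2 * (b * (1 / c - 1) / \<alpha>)\<^sup>2"
      proof cases
        case 1
        then have "c * u \<le> 0" using c by (simp add: mult_le_0_iff)
        then have "1 \<le> \<bar>y / \<gamma>\<bar>" using w \<gamma> by (simp add: y_def)
        from sq[OF this] have "y\<^sup>2 * 1 \<le> y\<^sup>2 * (y / \<gamma>)\<^sup>2" by (intro mult_left_mono) auto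
        then show ?thesis by (simp add: power_divide)
      next
        case 2
        then have "1 \<le> b * \<bar>u - w\<bar> / \<alpha>" using alpha_pos by simp
        also have "\<dots> = \<bar>(u - w) * (b / \<alpha>)\<bar>" using alpha_pos b_pos by (simp add: abs_mult)
        finally have "1 \<le> \<bar>(u - w) * (b / \<alpha>)\<bar>" .
        from sq[OF this] have "y\<^sup>2 * 1 \<le> y\<^sup>2 * ((u - w) * (b / \<alpha>))\<^sup>2" by (intro mult_left_mono) auto
        also have "\<dots> = y\<^sup>2 * (u - w)\<^sup>2 * (b / \<alpha>)\<^sup>2"
          by (simp only: power_mult_distrib mult.assoc)
        finally show ?thesis by blast
      next
        case 3
        then have "1 \<le> b * (1 / c - 1) * \<bar>w\<bar> / \<alpha>" using alpha_pos by simp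
        also have "\<dots> = \<bar>w * (b * (1 / c - 1) / \<alpha>)\<bar>"
          using alpha_pos b_pos c1 by (simp add: abs_mult)
        finally have "1 \<le> \<bar>w * (b * (1 / c - 1) / \<alpha>)\<bar>" .
        from sq[OF this] have "y\<^sup>2 * 1 \<le> y\<^sup>2 * (w * (b * (1 / c - 1) / \<alpha>))\<^sup>2"
          by (intro mult_left_mono) auto
        also have "\<dots> = y\<^sup>2 * w\<^sup>2 * (b * (1 / c - 1) / \<alpha>)\<^sup>2"
          by (simp only: power_mult_distrib mult.assoc)
        finally show ?thesis by blast
      qed
      moreover have "?R = y\<^sup>2 * 1 - y\<^sup>2 * y\<^sup>2 / \<gamma>\<^sup>2 - y\<^sup>2 * (u - w)\<^sup>2 * (b / \<alpha>)\<^sup>2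
          - y\<^sup>2 * w\<^sup>2 * (b * (1 / c - 1) / \<alpha>)\<^sup>2"
        using w by simp
      ultimately show ?thesis using nn by (elim disjE) linarith+
    next
      case w: False
      then have "?R = 0 - y\<^sup>2 * y\<^sup>2 / \<gamma>\<^sup>2 - y\<^sup>2 * (u - w)\<^sup>2 * (b / \<alpha>)\<^sup>2
          - y\<^sup>2 * w\<^sup>2 * (b * (1 / c - 1) / \<alpha>)\<^sup>2"
        by simp
      then show ?thesis using nn by linarith
    qed
    with k have "?k * ?R \<le> 0" by (rule mult_nonneg_nonpos)
    moreover have "s * ((g A - g B) * y) \<le> 0" using s(1) neg by (rule mult_nonneg_nonpos)
    ultimately show ?thesis by linarith
  qed
  with base show ?thesis by (simp add: A_def)
qed

end

text \<open>The expectation of the pointwise bound, with \<open>r\<close> the sine and \<open>r / c\<close> the tangent of the angle. The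
  three Markov terms take away less than half of \<open>lam\<close>, and the replacement error is at most half
  of what is left of the gain.\<close>

lemma descent_arith:
  fixes a b l m B lam \<gamma> \<alpha> c r :: real
  assumes pos: "0 < a" "a \<le> b" "0 < m" "m \<le> l" "0 < B" "0 < lam" "lam \<le> sqrt B" "0 < \<gamma>" "0 < \<alpha>"
    and c: "0 < c" "c \<le> 1" and r: "0 \<le> r" "r\<^sup>2 = 1 - c\<^sup>2"
    and h1: "r / c \<le> a * m * lam / (4 * (b * l) * sqrt B)"
    and h2: "r / c \<le> \<gamma> * sqrt (lam / (4 * B))"
    and h3: "r \<le> \<alpha> / (8 * b) * sqrt (lam / B)"
  shows "l * b * (1 / c - 1) * (sqrt B * r) - (m * a / c) * (lam * r\<^sup>2 - B * r\<^sup>2 * r\<^sup>2 / \<gamma>\<^sup>2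
      - B * r\<^sup>2 * (2 - 2 * c) * (b / \<alpha>)\<^sup>2 - B * r\<^sup>2 * (b * (1 / c - 1) / \<alpha>)\<^sup>2) \<le> - (a * m * lam / 4) * r\<^sup>2"
proof -
  have b: "0 < b" and l: "0 < l" using pos by auto
  have sB: "0 < sqrt B" using pos by simp
  have c2: "c\<^sup>2 \<le> c" using c by (simp add: power2_eq_square mult_left_le_one_le)
  have r_le: "r \<le> r / c" using c r by (simp add: pos_le_divide_eq mult_right_le_one_le)
  have e1: "1 / c - 1 \<le> r * (r / c)"
  proof -
    have "1 / c - 1 = (1 - c) / c" using c by (simp add: diff_divide_distrib)
    also have "\<dots> \<le> r\<^sup>2 / c" using c c2 r by (intro divide_right_mono) auto
    finally show ?thesis by (simp add: power2_eq_square)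
  qed
  have c1: "0 \<le> 1 / c - 1" using c by simp
  have tau1: "r / c \<le> 1"
  proof -
    have "a * m * lam \<le> b * l * sqrt B" using pos by (intro mult_mono) auto
    also have "\<dots> \<le> 1 * (4 * (b * l) * sqrt B)" using b l sB by simp
    finally have "a * m * lam / (4 * (b * l) * sqrt B) \<le> 1"
      using b l sB by (subst pos_divide_le_eq) auto
    with h1 show ?thesis by linarith
  qed
  have err: "l * b * (1 / c - 1) * (sqrt B * r) \<le> a * m * lam / 4 * r\<^sup>2"
  proof -
    have "l * b * (1 / c - 1) * (sqrt B * r) \<le> l * b * (r * (r / c)) * (sqrt B * r)"
      using e1 b l sB r by (intro mult_right_mono mult_left_mono) auto
    also have "\<dots> = (b * l * sqrt B * r\<^sup>2) * (r / c)" by (simp add: power2_eq_square)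
    also have "\<dots> \<le> (b * l * sqrt B * r\<^sup>2) * (a * m * lam / (4 * (b * l) * sqrt B))"
      using h1 b l sB by (intro mult_left_mono) auto
    also have "\<dots> = a * m * lam / 4 * r\<^sup>2" using b l sB by (simp add: field_simps)
    finally show ?thesis .
  qed
  have t1: "B * r\<^sup>2 / \<gamma>\<^sup>2 \<le> lam / 4"
  proof -
    have "r\<^sup>2 \<le> (\<gamma> * sqrt (lam / (4 * B)))\<^sup>2" using r_le h2 r by (intro power_mono) auto
    also have "\<dots> = \<gamma>\<^sup>2 * (lam / (4 * B))" using pos by (simp add: power_mult_distrib)
    finally show ?thesis using pos by (simp add: field_simps)
  qed
  have r3: "B * (b / \<alpha>)\<^sup>2 * r\<^sup>2 \<le> lam / 64"
  proof -
    have "r\<^sup>2 \<le> (\<alpha> / (8 * b) * sqrt (lam / B))\<^sup>2" using h3 r by (intro power_mono) auto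
    also have "\<dots> = \<alpha>\<^sup>2 / (64 * b\<^sup>2) * (lam / B)" using pos by (simp add: power_mult_distrib power_divide)
    finally show ?thesis using pos b by (simp add: field_simps)
  qed
  have t2: "B * (2 - 2 * c) * (b / \<alpha>)\<^sup>2 \<le> lam / 32"
  proof -
    have "B * (b / \<alpha>)\<^sup>2 * (2 - 2 * c) \<le> B * (b / \<alpha>)\<^sup>2 * (2 * r\<^sup>2)"
      using pos c2 r by (intro mult_left_mono) auto
    with r3 show ?thesis by (simp add: ac_simps)
  qed
  have t3: "B * (b * (1 / c - 1) / \<alpha>)\<^sup>2 \<le> lam / 64"
  proof -
    have "1 / c - 1 \<le> r" using e1 mult_left_mono[OF tau1 r(1)] by simp
    then have "(1 / c - 1)\<^sup>2 \<le> r\<^sup>2" using c1 by (intro power_mono)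
    then have "B * (b / \<alpha>)\<^sup>2 * (1 / c - 1)\<^sup>2 \<le> B * (b / \<alpha>)\<^sup>2 * r\<^sup>2"
      using pos by (intro mult_left_mono) auto
    moreover have "B * (b * (1 / c - 1) / \<alpha>)\<^sup>2 = B * (b / \<alpha>)\<^sup>2 * (1 / c - 1)\<^sup>2"
      by (simp add: power_mult_distrib power_divide)
    ultimately show ?thesis using r3 by linarith
  qed
  let ?R = "lam - B * r\<^sup>2 / \<gamma>\<^sup>2 - B * (2 - 2 * c) * (b / \<alpha>)\<^sup>2 - B * (b * (1 / c - 1) / \<alpha>)\<^sup>2"
  have R: "lam / 2 \<le> ?R" using t1 t2 t3 pos by linarith
  have "a * m * (lam / 2 * r\<^sup>2) \<le> (m * a / c) * (?R * r\<^sup>2)"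
  proof (rule mult_mono)
    show "a * m \<le> m * a / c" using c pos by (simp add: pos_le_divide_eq mult_right_le_one_le)
    show "lam / 2 * r\<^sup>2 \<le> ?R * r\<^sup>2" using R by (rule mult_right_mono) simp
  qed (use pos c in auto)
  also have "?R * r\<^sup>2 = lam * r\<^sup>2 - B * r\<^sup>2 * r\<^sup>2 / \<gamma>\<^sup>2
      - B * r\<^sup>2 * (2 - 2 * c) * (b / \<alpha>)\<^sup>2 - B * r\<^sup>2 * (b * (1 / c - 1) / \<alpha>)\<^sup>2" (is "_ = ?S")
    by (simp add: algebra_simps)
  finally have main: "a * m * (lam / 2 * r\<^sup>2) \<le> (m * a / c) * ?S" .
  have "l * b * (1 / c - 1) * (sqrt B * r) - (m * a / c) * ?S
      \<le> a * m * lam / 4 * r\<^sup>2 - a * m * (lam / 2 * r\<^sup>2)"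
    using err main by (rule diff_mono)
  also have "\<dots> = - (a * m * lam / 4) * r\<^sup>2" by simp
  finally show ?thesis .
qed

section \<open>The surrogate, squared and Huber losses\<close>

text \<open>The subgradient inequality expresses that \<open>\<phi>\<close> is convex with derivative \<open>g\<close>.\<close>

lemma convex_subgradient_secant:
  fixes \<phi> g :: "real \<Rightarrow> real"
  assumes sub: "\<And>s t. \<phi> s + g s * (t - s) \<le> \<phi> t"
    and lip: "\<And>s t. \<bar>g s - g t\<bar> \<le> K * \<bar>s - t\<bar>"
  obtains r where "\<phi> t - \<phi> s = r * (t - s)" "\<bar>r - g s\<bar> \<le> K * \<bar>t - s\<bar>"
proof (cases "s = t")
  case True
  then show thesis using that[of "g s"] by simp
next
  case False
  define r where "r = (\<phi> t - \<phi> s) / (t - s)"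
  have r: "\<phi> t - \<phi> s = r * (t - s)" using False by (simp add: r_def)
  have lo: "g s * (t - s) \<le> r * (t - s)" and hi: "r * (t - s) \<le> g t * (t - s)"
    using sub[of s t] sub[of t s] r by (simp_all add: algebra_simps)
  have "\<bar>r - g s\<bar> \<le> \<bar>g t - g s\<bar>"
  proof (cases "s < t")
    case True
    then show ?thesis using lo hi by (simp add: mult_le_cancel_right)
  next
    case st: False
    then have "t < s" using False by simp
    then show ?thesis using lo hi by (simp add: mult_le_cancel_right)
  qed
  also have "\<dots> \<le> K * \<bar>t - s\<bar>" by (rule lip)
  finally show thesis using r that by blast
qed

context truncated_activation
begin

lemma composite_loss:
  fixes \<phi> :: "real \<Rightarrow> real"
  assumes sub: "\<And>s t. \<phi> s + g s * (t - s) \<le> \<phi> t"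
    and \<phi>0: "\<phi> 0 = 0" and \<phi>_cont: "continuous_on UNIV \<phi>"
  shows "sample_loss (\<lambda>u w. \<phi> (\<sigma> u - \<sigma> w)) (\<lambda>u w. g (\<sigma> u - \<sigma> w)) b b a (2 * b\<^sup>2)"
proof
  show "continuous_on UNIV (\<lambda>v :: real \<times> real. \<phi> (\<sigma> (fst v) - \<sigma> (snd v)))"
    by (intro continuous_on_compose2[OF \<phi>_cont] continuous_intros
        continuous_on_compose2[OF continuous]) auto
  show "\<bar>\<phi> (\<sigma> u - \<sigma> w)\<bar> \<le> 2 * b\<^sup>2 * (u\<^sup>2 + w\<^sup>2)" for u w
  proof -
    let ?t = "\<sigma> u - \<sigma> w"
    have "0 \<le> \<phi> t" "\<phi> t \<le> g t * t" for t using sub[of 0 t] sub[of t 0] by (simp_all add: g_0 \<phi>0)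
    note this[of ?t]
    then have "\<bar>\<phi> ?t\<bar> \<le> \<bar>g ?t\<bar> * \<bar>?t\<bar>" by (metis abs_ge_self abs_mult abs_of_nonneg order_trans)
    also have "\<dots> \<le> \<bar>?t\<bar> * \<bar>?t\<bar>" using g_abs_le by (intro mult_right_mono) auto
    also have "\<dots> \<le> (b * \<bar>u - w\<bar>) * (b * \<bar>u - w\<bar>)" using lipschitz b_pos by (intro mult_mono) auto
    also have "\<dots> = b\<^sup>2 * (u - w)\<^sup>2" by (simp add: power2_eq_square abs_mult_self_eq algebra_simps flip: abs_mult)
    also have "\<dots> \<le> b\<^sup>2 * (2 * (u\<^sup>2 + w\<^sup>2))"
    proof (rule mult_left_mono)
      have "0 \<le> (u + w)\<^sup>2" by simp
      then show "(u - w)\<^sup>2 \<le> 2 * (u\<^sup>2 + w\<^sup>2)" by (simp add: power2_sum power2_diff)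
    qed simp
    finally show ?thesis by (simp add: algebra_simps)
  qed
  show "\<bar>g (\<sigma> u - \<sigma> w) - g (\<sigma> u' - \<sigma> w)\<bar> \<le> b * \<bar>u - u'\<bar>" for u u' w
    using g_lipschitz[of "\<sigma> u - \<sigma> w" "\<sigma> u' - \<sigma> w"] lipschitz[of u u'] by simp
  show "g (\<sigma> w - \<sigma> w) = 0" for w by (simp add: g_0)
  fix u u' w
  obtain s where s: "\<sigma> u' - \<sigma> u = s * (u' - u)" "0 \<le> s" "s \<le> b" "0 < u \<and> 0 < u' \<longrightarrow> a \<le> s"
    using secant by blast
  obtain r where r: "\<phi> (\<sigma> u' - \<sigma> w) - \<phi> (\<sigma> u - \<sigma> w) = r * ((\<sigma> u' - \<sigma> w) - (\<sigma> u - \<sigma> w))"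
    "\<bar>r - g (\<sigma> u - \<sigma> w)\<bar> \<le> 1 * \<bar>(\<sigma> u' - \<sigma> w) - (\<sigma> u - \<sigma> w)\<bar>"
    by (rule convex_subgradient_secant[of \<phi> g 1 "\<sigma> u' - \<sigma> w" "\<sigma> u - \<sigma> w"]) (auto simp: sub g_lipschitz)
  show "\<exists>r s. \<phi> (\<sigma> u' - \<sigma> w) - \<phi> (\<sigma> u - \<sigma> w) = r * s * (u' - u) \<and>
      \<bar>r - g (\<sigma> u - \<sigma> w)\<bar> \<le> b * \<bar>u' - u\<bar> \<and> 0 \<le> s \<and> s \<le> b \<and> (0 < u \<and> 0 < u' \<longrightarrow> a \<le> s)"
    using r s lipschitz[of u' u] by (intro exI[of _ r] exI[of _ s]) auto
qed

end

context activation
begin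

text \<open>The antiderivative of \<open>\<sigma>\<close> that vanishes at \<open>0\<close>, through which the surrogate loss of one sample is
  \<open>primitive u - u * \<sigma> w\<close>.\<close>

definition primitive :: "real \<Rightarrow> real" where
  "primitive u = (LBINT s=ereal 0..ereal u. \<sigma> s)"

lemma interval_integrable: "interval_lebesgue_integrable lborel (ereal p) (ereal q) \<sigma>"
  using continuous by (intro interval_integrable_isCont) (simp add: continuous_on_eq_continuous_at)

lemma surrogate_eq: "(LBINT s=ereal 0..ereal u. \<sigma> s - \<sigma> w) = primitive u - u * \<sigma> w"
proof -
  have "interval_lebesgue_integrable lborel (ereal 0) (ereal u) (\<lambda>_. \<sigma> w)"
    by (intro interval_integrable_isCont) auto
  then have "(LBINT s=ereal 0..ereal u. \<sigma> s - \<sigma> w) = primitive u - (LBINT s=ereal 0..ereal u. \<sigma> w)"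
    unfolding primitive_def by (intro interval_lebesgue_integral_diff interval_integrable)
  also have "(LBINT s=ereal 0..ereal u. \<sigma> w) = u * \<sigma> w"
    using interval_integral_const[of 0 u "\<sigma> w"] by simp
  finally show ?thesis .
qed

lemma primitive_deriv: "(primitive has_real_derivative \<sigma> x) (at x)"
proof -
  define p where "p = - \<bar>x\<bar> - 1"
  define q where "q = \<bar>x\<bar> + 1"
  have pq: "p \<le> 0" "0 \<le> q" "p < x" "x < q" by (auto simp: p_def q_def)
  have "((\<lambda>u. LBINT s=ereal 0..ereal u. \<sigma> s) has_vector_derivative \<sigma> x) (at x within {p..q})"
    using pq by (intro interval_integral_FTC2 continuous_on_subset[OF continuous]) auto
  then have "(primitive has_vector_derivative \<sigma> x) (at x within {p..q})"
    by (simp add: primitive_def[abs_def])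
  moreover have "at x within {p..q} = at x"
    using pq by (intro at_within_Icc_at)
  ultimately show ?thesis by (simp add: has_real_derivative_iff_has_vector_derivative)
qed

lemma surrogate_subgradient:
  "(primitive s - s * \<sigma> w) + (\<sigma> s - \<sigma> w) * (t - s) \<le> primitive t - t * \<sigma> w"
proof -
  have "\<sigma> s * (t - s) \<le> primitive t - primitive s"
  proof (cases "s < t")
    case True
    obtain z where z: "s < z" "z < t" "primitive t - primitive s = (t - s) * \<sigma> z"
      using MVT2[OF True] primitive_deriv by blast
    then show ?thesis using nondecreasing[of s z] by (simp add: mult_left_mono mult.commute)
  next
    case False
    show ?thesis
    proof (cases "s = t")
      case neq: False
      with False have "t < s" by simp
      then obtain z where z: "t < z" "z < s" "primitive s - primitive t = (s - t) * \<sigma> z"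
        using MVT2[of t s primitive \<sigma>] primitive_deriv by blast
      then have "(s - t) * \<sigma> z \<le> (s - t) * \<sigma> s" using nondecreasing[of z s] by (intro mult_left_mono) auto
      with z show ?thesis by (simp add: algebra_simps)
    qed simp
  qed
  then show ?thesis by (simp add: algebra_simps)
qed

text \<open>The gradient of the surrogate loss carries no factor from the slope of \<open>\<sigma>\<close>, whence the slope
  bounds \<open>l = m = 1\<close>.\<close>

lemma surrogate_loss:
  "sample_loss (\<lambda>u w. primitive u - u * \<sigma> w) (\<lambda>u w. \<sigma> u - \<sigma> w) b 1 1 (2 * b)"
proof
  have secant: "\<exists>r. (primitive u' - u' * \<sigma> w) - (primitive u - u * \<sigma> w) = r * (u' - u) \<and>
      \<bar>r - (\<sigma> u - \<sigma> w)\<bar> \<le> b * \<bar>u' - u\<bar>" for u u' w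
    using convex_subgradient_secant[of "\<lambda>u. primitive u - u * \<sigma> w" "\<lambda>u. \<sigma> u - \<sigma> w" b u' u]
      surrogate_subgradient lipschitz by (metis add_diff_cancel_right diff_diff_eq2 diff_add_cancel)
  have prim_cont: "continuous_on UNIV primitive"
    using primitive_deriv by (auto intro!: continuous_at_imp_continuous_on DERIV_isCont)
  show "continuous_on UNIV (\<lambda>v :: real \<times> real. primitive (fst v) - fst v * \<sigma> (snd v))"
    by (intro continuous_on_compose2[OF prim_cont] continuous_intros
        continuous_on_compose2[OF continuous]) auto
  show "\<bar>primitive u - u * \<sigma> w\<bar> \<le> 2 * b * (u\<^sup>2 + w\<^sup>2)" for u w
  proof -
    have "primitive 0 = 0" by (simp add: primitive_def)
    then obtain r where r: "primitive u - u * \<sigma> w = r * u" "\<bar>r - (\<sigma> 0 - \<sigma> w)\<bar> \<le> b * \<bar>u\<bar>"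
      using secant[of u w 0] by auto
    have "\<bar>r\<bar> \<le> b * (\<bar>u\<bar> + \<bar>w\<bar>)"
      using r(2) lipschitz[of 0 w] by (simp add: algebra_simps)
    then have "\<bar>r * u\<bar> \<le> b * (\<bar>u\<bar> + \<bar>w\<bar>) * \<bar>u\<bar>" unfolding abs_mult by (rule mult_right_mono) simp
    also have "\<dots> = b * ((\<bar>u\<bar> + \<bar>w\<bar>) * \<bar>u\<bar>)" by simp
    also have "\<dots> \<le> b * (2 * (u\<^sup>2 + w\<^sup>2))"
    proof (rule mult_left_mono)
      have "0 \<le> (\<bar>u\<bar> - \<bar>w\<bar>)\<^sup>2" by simp
      then have "2 * (\<bar>u\<bar> * \<bar>w\<bar>) \<le> u\<^sup>2 + w\<^sup>2" by (simp add: power2_diff)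
      moreover have "0 \<le> \<bar>u\<bar> * \<bar>w\<bar>" by simp
      ultimately have uw: "\<bar>u\<bar> * \<bar>w\<bar> \<le> u\<^sup>2 + w\<^sup>2" by linarith
      have "(\<bar>u\<bar> + \<bar>w\<bar>) * \<bar>u\<bar> = u\<^sup>2 + \<bar>u\<bar> * \<bar>w\<bar>"
        by (simp add: power2_eq_square algebra_simps)
      also have "\<dots> \<le> u\<^sup>2 + (u\<^sup>2 + w\<^sup>2)" using uw by simp
      also have "\<dots> \<le> 2 * (u\<^sup>2 + w\<^sup>2)" by simp
      finally show "(\<bar>u\<bar> + \<bar>w\<bar>) * \<bar>u\<bar> \<le> 2 * (u\<^sup>2 + w\<^sup>2)" .
    qed (use b_pos in simp)
    finally show ?thesis using r(1) by (simp add: algebra_simps)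
  qed
  show "\<bar>(\<sigma> u - \<sigma> w) - (\<sigma> u' - \<sigma> w)\<bar> \<le> b * \<bar>u - u'\<bar>" for u u' w
    using lipschitz[of u u'] by simp
  show "\<exists>r s. (primitive u' - u' * \<sigma> w) - (primitive u - u * \<sigma> w) = r * s * (u' - u) \<and>
      \<bar>r - (\<sigma> u - \<sigma> w)\<bar> \<le> b * \<bar>u' - u\<bar> \<and> 0 \<le> s \<and> s \<le> 1 \<and> (0 < u \<and> 0 < u' \<longrightarrow> 1 \<le> s)" for u u' w
    using secant[of u' w u] by (metis mult.right_neutral order_refl zero_le_one)
qed simp

end

text \<open>Truncation to \<open>[- \<alpha>, \<alpha>]\<close>, the derivative of the Huber function.\<close>

definition clip :: "real \<Rightarrow> real \<Rightarrow> real" where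
  "clip \<alpha> t = max (- \<alpha>) (min \<alpha> t)"

lemma huber_eq: "0 < \<alpha> \<Longrightarrow> huber \<alpha> t = clip \<alpha> t * t - (clip \<alpha> t)\<^sup>2 / 2"
  by (auto simp: huber_def clip_def max_def min_def abs_if power2_eq_square algebra_simps)

lemma clip_truncation: "0 < \<alpha> \<Longrightarrow> truncation (clip \<alpha>) \<alpha>"
  by unfold_locales (auto simp: clip_def max_def min_def)

text \<open>The Huber function at \<open>t\<close> is the maximum of \<open>p * t - p\<^sup>2 / 2\<close> over \<open>p\<close> in \<open>[- \<alpha>, \<alpha>]\<close>, attained at
  \<open>p = clip \<alpha> t\<close>.\<close>

lemma huber_subgradient:
  assumes "0 < \<alpha>"
  shows "huber \<alpha> s + clip \<alpha> s * (t - s) \<le> huber \<alpha> t"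
proof -
  define p where "p = clip \<alpha> s"
  define q where "q = clip \<alpha> t"
  have "0 \<le> (q - p) * (2 * t - (p + q))"
  proof (cases "p \<le> q")
    case True
    then have "p + q \<le> 2 * t \<or> p = q" using assms by (auto simp: p_def q_def clip_def max_def min_def split: if_splits)
    then show ?thesis using True by (elim disjE) (auto intro!: mult_nonneg_nonneg)
  next
    case False
    then have "2 * t \<le> p + q" using assms by (auto simp: p_def q_def clip_def max_def min_def split: if_splits)
    then show ?thesis using False by (auto intro!: mult_nonpos_nonpos)
  qed
  then show ?thesis
    using assms by (simp add: huber_eq p_def[symmetric] q_def[symmetric]) (simp add: power2_eq_square algebra_simps)
qed

lemma identity_truncation: "0 < \<alpha> \<Longrightarrow> truncation (\<lambda>t. t) \<alpha>"
  by unfold_locales auto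

text \<open>Only points of differentiability are used: they have full measure, so the bounds there already
  determine the slopes.\<close>

lemma activation_of_unbounded_activations:
  assumes \<sigma>: "\<sigma> \<in> unbounded_activations a b" and ab: "0 < a" "a \<le> b"
  shows "activation \<sigma> a b"
proof
  obtain L where L: "L-lipschitz_on UNIV \<sigma>" using \<sigma> by (auto simp: unbounded_activations_def)
  have d: "0 \<le> D" "D \<le> b" "0 < s \<Longrightarrow> a \<le> D" if "(\<sigma> has_real_derivative D) (at s)" for s D
    using \<sigma> that DERIV_imp_deriv[OF that]
    by (auto simp: unbounded_activations_def real_differentiable_def)
  show "0 < a" "a \<le> b" by fact+
  fix s t :: real
  show "\<sigma> s \<le> \<sigma> t" if "s \<le> t"
    using lipschitz_slope_ge[OF L that, of 0] d by simp
  show "a * (t - s) \<le> \<sigma> t - \<sigma> s" if "0 \<le> s" "s \<le> t"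
    using lipschitz_slope_ge[OF L that(2), of a] d(3) that(1) by simp
  show "\<sigma> t - \<sigma> s \<le> b * (t - s)" if "s \<le> t"
  proof -
    have "- b * (t - s) \<le> - \<sigma> t - - \<sigma> s"
    proof (rule lipschitz_slope_ge)
      show "L-lipschitz_on UNIV (\<lambda>s. - \<sigma> s)" using L by (rule lipschitz_on_minus)
      show "- b \<le> D" if "((\<lambda>s. - \<sigma> s) has_real_derivative D) (at y)" for y D
        using d(2)[of "- D" y] DERIV_minus[OF that] by simp
    qed (fact that)
    then show ?thesis by simp
  qed
qed

text \<open>Linearity of the integral for the shape of \<open>pointwise_descent\<close>, with abstract functions so that
  the simplifier cannot regroup the products of moments.\<close>

lemma
  fixes F1 F2 F3 F4 F5 :: "'a \<Rightarrow> real"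
  assumes F: "integrable M F1" "integrable M F2" "integrable M F3" "integrable M F4" "integrable M F5"
  shows integrable_descent_bound:
      "integrable M (\<lambda>z. k1 * F1 z - k2 * (F2 z - F3 z / k3 - F4 z * k4 - F5 z * k5))"
    and integral_descent_bound:
      "(\<integral>z. k1 * F1 z - k2 * (F2 z - F3 z / k3 - F4 z * k4 - F5 z * k5) \<partial>M)
        = k1 * integral\<^sup>L M F1 - k2 * (integral\<^sup>L M F2 - integral\<^sup>L M F3 / k3
            - integral\<^sup>L M F4 * k4 - integral\<^sup>L M F5 * k5)"
  using F by simp_all

context fourth_moments
begin

text \<open>The two bounds defining \<open>?K\<close> below, one on the component along \<open>v\<close> and one on the norm, hold for
  limiting gradients and describe a convex set, so they pass to the Clarke subdifferential. Their
  quotient is the constant of the conclusion times the sine of the angle.\<close>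

lemma RGA_of_sample_loss:
  fixes xs x :: "real^'d"
  assumes act: "truncated_activation \<sigma> a b g \<alpha>"
    and loss: "sample_loss \<Phi> (\<lambda>u w. g (\<sigma> u - \<sigma> w)) b l m C"
    and lm: "0 < m" "m \<le> l"
    and pos: "0 < lam" "0 < \<gamma>"
    and unit: "norm xs = 1" "norm x = 1"
    and low: "loewner_ge (\<integral>z. indicat_real {z. xs \<bullet> z \<ge> \<gamma>} z *\<^sub>R outer z z \<partial>D) (lam *\<^sub>R mat 1)"
    and angle_pos: "0 < sph_angle x xs"
    and angle1: "sph_angle x xs \<le> arctan (a * m * lam / (4 * (b * l) * sqrt B))"
    and angle2: "sph_angle x xs \<le> arctan (\<gamma> * sqrt (lam / (4 * B)))"
    and angle3: "sin (sph_angle x xs) \<le> \<alpha> / (8 * b) * sqrt (lam / B)"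
    and f: "\<And>y. f y = (\<integral>z. \<Phi> (y \<bullet> z) (xs \<bullet> z) \<partial>D)"
    and G: "G \<in> riem_clarke_subdiff f x"
  shows "RGA (a * m * lam / (8 * (b * l) * sqrt B)) x xs G"
proof -
  interpret truncated_activation \<sigma> a b g \<alpha> by (rule act)
  interpret sample_loss \<Phi> "\<lambda>u w. g (\<sigma> u - \<sigma> w)" b l m C by (rule loss)
  define c where "c = x \<bullet> xs"
  define r where "r = sin (sph_angle x xs)"
  define v where "v = xs - c *\<^sub>R x"
  have c_abs: "\<bar>c\<bar> \<le> 1" using Cauchy_Schwarz_ineq2[of x xs] unit by (simp add: c_def)
  have angle_lt: "sph_angle x xs < pi / 2"
    using angle2 arctan_ubound by (rule le_less_trans)
  have cos_c: "cos (sph_angle x xs) = c"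
    using c_abs by (simp add: sph_angle_def c_def cos_arccos_abs)
  have c: "0 < c" "c \<le> 1" using cos_gt_zero[OF angle_pos angle_lt] cos_c c_abs by auto
  have r_pos: "0 < r" using sin_gt_zero[OF angle_pos] angle_lt pi_gt_zero by (simp add: r_def)
  have r_sq: "r\<^sup>2 = 1 - c\<^sup>2" unfolding r_def cos_c[symmetric] by (rule sin_squared_eq)
  have tan_le: "r / c \<le> T" if "sph_angle x xs \<le> arctan T" for T
  proof -
    have "tan (sph_angle x xs) \<le> tan (arctan T)"
      using that angle_pos angle_lt arctan_ubound[of T] arctan_lbound[of T]
      by (subst tan_mono_le_eq) auto
    moreover have "tan (sph_angle x xs) = r / c" by (simp add: tan_def cos_c r_def)
    ultimately show ?thesis by (simp add: tan_arctan)
  qed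
  have lam_le: "lam \<le> sqrt B"
  proof -
    have "lam \<le> (\<integral>z. indicat_real {z. xs \<bullet> z \<ge> \<gamma>} z * (xs \<bullet> z)\<^sup>2 \<partial>D)"
      using loewner_moment[OF low, of xs] unit by simp
    also have "\<dots> \<le> (\<integral>z. \<bar>xs \<bullet> z\<bar> * \<bar>xs \<bullet> z\<bar> \<partial>D)"
      by (rule integral_mono_AE') (use moment11(1)[of xs xs] in \<open>auto simp: indicator_def power2_eq_square\<close>)
    also have "\<dots> \<le> sqrt B" using moment11(2)[of xs xs] unit by simp
    finally show ?thesis .
  qed
  have xx: "x \<bullet> x = 1" "xs \<bullet> xs = 1" using unit by (simp_all flip: power2_norm_eq_inner)
  have norm_v: "(norm v)\<^sup>2 = r\<^sup>2"
  proof -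
    have "v \<bullet> v = 1 - c * c"
      using xx c_def by (simp add: v_def inner_diff_left inner_diff_right inner_commute)
    then show ?thesis by (simp add: power2_norm_eq_inner r_sq power2_eq_square[of c])
  qed
  then have norm_v': "norm v = r" using r_pos by (simp add: power2_eq_iff_nonneg)
  have norm_d: "(norm (x - xs))\<^sup>2 = 2 - 2 * c"
    by (simp add: power2_norm_eq_inner inner_diff_left inner_diff_right xx inner_commute c_def)
  have norm_d': "norm (x - xs) \<le> 2 * r"
  proof (rule power2_le_imp_le)
    have "c\<^sup>2 \<le> c" using c by (simp add: power2_eq_square mult_left_le_one_le)
    then have "2 - 2 * c \<le> 4 * r\<^sup>2" using c r_sq by simp
    then show "(norm (x - xs))\<^sup>2 \<le> (2 * r)\<^sup>2" by (simp add: norm_d power_mult_distrib)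
  qed (use r_pos in simp)
  let ?M = "a * m * lam / 4 * r\<^sup>2" and ?N = "l * b * sqrt B * (2 * r)"
  let ?K = "{\<xi>. v \<bullet> \<xi> \<le> - ?M} \<inter> cball 0 ?N"
  have lb: "0 < l" "0 \<le> l * b" using lm b_pos by auto
  have f_eq: "f = (\<lambda>y. \<integral>z. \<Phi> (y \<bullet> z) (xs \<bullet> z) \<partial>D)" by (rule ext) (rule f)
  have limiting: "\<xi> \<in> ?K" if y: "y \<longlonglongrightarrow> x" and GD: "\<And>k::nat. GDERIV f (y k) :> H k" "H \<longlonglongrightarrow> \<xi>" for y H \<xi>
  proof -
    have GD': "GDERIV (\<lambda>y. \<integral>z. \<Phi> (y \<bullet> z) (xs \<bullet> z) \<partial>D) (y k) :> H k" for k
      using GD(1)[of k] unfolding f_eq .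
    note bound = limiting_gradient_le[OF loss y GD' GD(2)]
    have "\<xi> \<bullet> v \<le> - ?M"
    proof -
      let ?H = "\<lambda>z. l * b * (1 / c - 1) * (\<bar>xs \<bullet> z\<bar> * \<bar>v \<bullet> z\<bar>)
        - (m * a / c) * (indicat_real {z. xs \<bullet> z \<ge> \<gamma>} z * (v \<bullet> z)\<^sup>2 - (v \<bullet> z)\<^sup>2 * (v \<bullet> z)\<^sup>2 / \<gamma>\<^sup>2
          - (v \<bullet> z)\<^sup>2 * ((x - xs) \<bullet> z)\<^sup>2 * (b / \<alpha>)\<^sup>2
          - (v \<bullet> z)\<^sup>2 * (xs \<bullet> z)\<^sup>2 * (b * (1 / c - 1) / \<alpha>)\<^sup>2)"
      have int1: "integrable D (\<lambda>z. indicat_real {z. xs \<bullet> z \<ge> \<gamma>} z * (v \<bullet> z)\<^sup>2)"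
        by (rule Bochner_Integration.integrable_bound[OF moment11(1)[of v v]])
          (auto simp: indicator_def power2_eq_square)
      note ints = moment11(1) int1 moment22(1) moment22(1) moment22(1)
      have H_int: "integrable D ?H" by (rule integrable_descent_bound[OF ints])
      have "\<xi> \<bullet> v \<le> (\<integral>z. ?H z \<partial>D)"
      proof (rule bound[OF H_int])
        fix z s assume s: "0 \<le> s" "s \<le> l" "0 < x \<bullet> z \<Longrightarrow> m \<le> s"
        have "v \<bullet> z = xs \<bullet> z - c * (x \<bullet> z)" by (simp add: v_def inner_diff_left)
        then show "s * g (\<sigma> (x \<bullet> z) - \<sigma> (xs \<bullet> z)) * (v \<bullet> z) \<le> ?H z"
          using pointwise_descent[OF c s _ pos(2), of "x \<bullet> z" "xs \<bullet> z"] lm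
          by (simp add: inner_diff_left indicator_def)
      qed
      also have "(\<integral>z. ?H z \<partial>D) = l * b * (1 / c - 1) * (\<integral>z. \<bar>xs \<bullet> z\<bar> * \<bar>v \<bullet> z\<bar> \<partial>D)
        - (m * a / c) * ((\<integral>z. indicat_real {z. xs \<bullet> z \<ge> \<gamma>} z * (v \<bullet> z)\<^sup>2 \<partial>D)
          - (\<integral>z. (v \<bullet> z)\<^sup>2 * (v \<bullet> z)\<^sup>2 \<partial>D) / \<gamma>\<^sup>2
          - (\<integral>z. (v \<bullet> z)\<^sup>2 * ((x - xs) \<bullet> z)\<^sup>2 \<partial>D) * (b / \<alpha>)\<^sup>2
          - (\<integral>z. (v \<bullet> z)\<^sup>2 * (xs \<bullet> z)\<^sup>2 \<partial>D) * (b * (1 / c - 1) / \<alpha>)\<^sup>2)"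
        by (rule integral_descent_bound[OF ints])
      also have "\<dots> \<le> l * b * (1 / c - 1) * (sqrt B * r) - (m * a / c) * (lam * r\<^sup>2 - B * r\<^sup>2 * r\<^sup>2 / \<gamma>\<^sup>2
          - B * r\<^sup>2 * (2 - 2 * c) * (b / \<alpha>)\<^sup>2 - B * r\<^sup>2 * (b * (1 / c - 1) / \<alpha>)\<^sup>2)"
      proof (intro diff_mono mult_left_mono mult_right_mono divide_right_mono)
        show "(\<integral>z. \<bar>xs \<bullet> z\<bar> * \<bar>v \<bullet> z\<bar> \<partial>D) \<le> sqrt B * r"
          using moment11(2)[of xs v] unit norm_v' by simp
        show "lam * r\<^sup>2 \<le> (\<integral>z. indicat_real {z. xs \<bullet> z \<ge> \<gamma>} z * (v \<bullet> z)\<^sup>2 \<partial>D)"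
          using loewner_moment[OF low, of v] norm_v by simp
        show "(\<integral>z. (v \<bullet> z)\<^sup>2 * (v \<bullet> z)\<^sup>2 \<partial>D) \<le> B * r\<^sup>2 * r\<^sup>2"
          using moment22(2)[of v v] norm_v by simp
        show "(\<integral>z. (v \<bullet> z)\<^sup>2 * ((x - xs) \<bullet> z)\<^sup>2 \<partial>D) \<le> B * r\<^sup>2 * (2 - 2 * c)"
          using moment22(2)[of v "x - xs"] norm_v norm_d by simp
        show "(\<integral>z. (v \<bullet> z)\<^sup>2 * (xs \<bullet> z)\<^sup>2 \<partial>D) \<le> B * r\<^sup>2"
          using moment22(2)[of v xs] norm_v unit by simp
        show "0 \<le> l * b * (1 / c - 1)" using lb b_pos c by (intro mult_nonneg_nonneg) auto
        show "0 \<le> m * a / c" using lm a_pos c by simp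
      qed simp_all
      also have "\<dots> \<le> - (a * m * lam / 4) * r\<^sup>2"
        using tan_le[OF angle1] tan_le[OF angle2] angle3 r_pos r_sq c lam_le pos alpha_pos B_pos lm a_pos a_le_b
        by (intro descent_arith) (auto simp: r_def)
      finally show ?thesis by simp
    qed
    moreover have "norm \<xi> \<le> ?N"
    proof -
      have "\<xi> \<bullet> \<xi> \<le> (\<integral>z. l * b * (\<bar>(x - xs) \<bullet> z\<bar> * \<bar>\<xi> \<bullet> z\<bar>) \<partial>D)"
      proof (rule bound)
        show "integrable D (\<lambda>z. l * b * (\<bar>(x - xs) \<bullet> z\<bar> * \<bar>\<xi> \<bullet> z\<bar>))"
          using moment11(1) by (rule integrable_mult_right)
        fix z s assume s: "0 \<le> s" "s \<le> l"
        let ?R = "g (\<sigma> (x \<bullet> z) - \<sigma> (xs \<bullet> z))"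
        have "s * ?R * (\<xi> \<bullet> z) \<le> \<bar>s * ?R * (\<xi> \<bullet> z)\<bar>" by simp
        also have "\<dots> = s * \<bar>?R\<bar> * \<bar>\<xi> \<bullet> z\<bar>" using s by (simp add: abs_mult)
        also have "\<dots> \<le> l * (b * \<bar>(x - xs) \<bullet> z\<bar>) * \<bar>\<xi> \<bullet> z\<bar>"
          using residual_le[of "x \<bullet> z" "xs \<bullet> z"] s
          by (intro mult_right_mono mult_mono) (auto simp: inner_diff_left)
        finally show "s * ?R * (\<xi> \<bullet> z) \<le> l * b * (\<bar>(x - xs) \<bullet> z\<bar> * \<bar>\<xi> \<bullet> z\<bar>)" by (simp add: ac_simps)
      qed
      also have "\<dots> = l * b * (\<integral>z. \<bar>(x - xs) \<bullet> z\<bar> * \<bar>\<xi> \<bullet> z\<bar> \<partial>D)" by simp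
      also have "\<dots> \<le> l * b * (sqrt B * norm (x - xs) * norm \<xi>)"
        using moment11(2) lb(2) by (rule mult_left_mono)
      also have "\<dots> \<le> l * b * (sqrt B * (2 * r) * norm \<xi>)"
        using norm_d' B_pos lb by (intro mult_left_mono mult_right_mono) auto
      finally have "norm \<xi> * norm \<xi> \<le> ?N * norm \<xi>"
        by (simp add: power2_norm_eq_inner[symmetric] power2_eq_square ac_simps)
      moreover have "0 \<le> ?N" using lb B_pos r_pos by simp
      ultimately show ?thesis by (cases "\<xi> = 0") (auto simp: mult_le_cancel_right)
    qed
    ultimately show ?thesis by (simp add: inner_commute)
  qed
  have "clarke_subdiff f x \<subseteq> ?K"
    unfolding clarke_subdiff_def
  proof (rule hull_minimal)
    show "convex ?K" by (intro convex_Int convex_halfspace_le convex_cball)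
  qed (use limiting in blast)
  moreover obtain \<xi> where \<xi>: "\<xi> \<in> clarke_subdiff f x" "G = (mat 1 - outer x x) *v \<xi>"
    using G by (auto simp: riem_clarke_subdiff_def)
  ultimately have \<xi>K: "v \<bullet> \<xi> \<le> - ?M" "norm \<xi> \<le> ?N" by auto
  have G_eq: "G = \<xi> - (x \<bullet> \<xi>) *\<^sub>R x"
    by (simp add: \<xi>(2) matrix_vector_mult_diff_rdistrib outer_mult_vec)
  have Gx: "G \<bullet> x = 0" by (simp add: G_eq inner_diff_left inner_diff_right xx inner_commute)
  have Gxs: "G \<bullet> xs = v \<bullet> \<xi>" by (simp add: G_eq v_def inner_diff_left inner_diff_right c_def inner_commute)
  have M_pos: "0 < ?M" using a_pos lm pos r_pos by simp
  have "G \<bullet> \<xi> = G \<bullet> G" using Gx by (simp add: G_eq inner_diff_right)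
  then have "norm G * norm G \<le> norm \<xi> * norm G"
    using norm_cauchy_schwarz[of G \<xi>] by (simp add: power2_norm_eq_inner[symmetric] power2_eq_square mult.commute)
  then have "norm G \<le> norm \<xi>" by (cases "G = 0") (auto simp: mult_le_cancel_right)
  then have G_le: "norm G \<le> ?N" using \<xi>K by simp
  have "a * m * lam / (8 * (b * l) * sqrt B) * r * norm G \<le> a * m * lam / (8 * (b * l) * sqrt B) * r * ?N"
    using G_le a_pos lm b_pos pos r_pos B_pos lb by (intro mult_left_mono) auto
  also have "\<dots> = ?M" using lb b_pos B_pos by (simp add: field_simps power2_eq_square)
  finally have "a * m * lam / (8 * (b * l) * sqrt B) * r * norm G \<le> ?M" .
  with \<xi>K(1) have "v \<bullet> \<xi> \<le> - (a * m * lam / (8 * (b * l) * sqrt B) * r * norm G)" by linarith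
  moreover have "G \<noteq> 0" using Gxs \<xi>K(1) M_pos by auto
  ultimately show ?thesis
    unfolding RGA_def r_def[symmetric] using Gx Gxs by simp
qed

end

theorem theorem5p30:
  fixes B\<^sub>4 \<gamma> lam a b :: real
    and xs :: "real^'d" and D :: "(real^'d) measure" and \<sigma> :: "real \<Rightarrow> real"
  assumes "B\<^sub>4 > 0" and "\<gamma> > 0" and "lam > 0"
    and "xs \<in> sphere 0 1"
    and "prob_space D" and "sets D = sets borel"
    and "loewner_ge (\<integral>z. indicat_real {z. xs \<bullet> z \<ge> \<gamma>} z *\<^sub>R outer z z \<partial>D) (lam *\<^sub>R mat 1)"
    and "\<And>\<rho>. \<rho> \<in> sphere 0 1 \<Longrightarrow>
           integrable D (\<lambda>z. (\<rho> \<bullet> z) ^ 4) \<and> (\<integral>z. (\<rho> \<bullet> z) ^ 4 \<partial>D) \<le> B\<^sub>4"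
    and "0 < a" and "a \<le> b"
    and "\<sigma> \<in> unbounded_activations a b"
  shows
    "(\<forall>x\<in>sphere 0 1.
        0 < sph_angle x xs \<and>
        sph_angle x xs \<le> min (arctan (a * lam / (4 * b * sqrt B\<^sub>4)))
                             (arctan (\<gamma> * sqrt (lam / (4 * B\<^sub>4)))) \<longrightarrow>
        (\<forall>g\<in>riem_clarke_subdiff (f_sur D \<sigma> xs) x.
           RGA (a * lam / (8 * b * sqrt B\<^sub>4)) x xs g))
     \<and>
     (\<forall>x\<in>sphere 0 1.
        0 < sph_angle x xs \<and>
        sph_angle x xs \<le> min (arctan (a\<^sup>2 * lam / (4 * b\<^sup>2 * sqrt B\<^sub>4)))
                             (arctan (\<gamma> * sqrt (lam / (4 * B\<^sub>4)))) \<longrightarrow>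
        (\<forall>g\<in>riem_clarke_subdiff (f_L2 D \<sigma> xs) x.
           RGA (a\<^sup>2 * lam / (8 * b\<^sup>2 * sqrt B\<^sub>4)) x xs g))
     \<and>
     (\<forall>\<alpha>>0. \<forall>x\<in>sphere 0 1.
        0 < sph_angle x xs \<and>
        sph_angle x xs \<le> min (arctan (a\<^sup>2 * lam / (4 * b\<^sup>2 * sqrt B\<^sub>4)))
                        (min (arctan (\<gamma> / 2 * sqrt (lam / B\<^sub>4)))
                             (arcsin (min 1 (\<alpha> / (8 * b) * sqrt (lam / B\<^sub>4))))) \<longrightarrow>
        (\<forall>g\<in>riem_clarke_subdiff (f_Hub D \<sigma> \<alpha> xs) x.
           RGA (a\<^sup>2 * lam / (8 * b\<^sup>2 * sqrt B\<^sub>4)) x xs g))"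
proof -
  interpret prob_space D by fact
  interpret fourth_moments D B\<^sub>4
    by unfold_locales (use assms(1,6,8) in \<open>auto simp: sphere_def dist_norm\<close>)
  interpret activation \<sigma> a b
    using assms(11,9,10) by (rule activation_of_unbounded_activations)
  have unit: "norm xs = 1" and unit_sphere: "\<And>x :: real^'d. x \<in> sphere 0 1 \<Longrightarrow> norm x = 1"
    using assms(4) by auto
  note lam = assms(3) and gam = assms(2) and low = assms(7)
  \<comment> \<open>The identity is a truncation at every level; at level \<open>\<beta>\<close> the bound on the sine of the angle
    becomes \<open>sin \<le> 1\<close>.\<close>
  define \<beta> where "\<beta> = 8 * b / sqrt (lam / B\<^sub>4)"
  have beta: "0 < \<beta>" "\<beta> / (8 * b) * sqrt (lam / B\<^sub>4) = 1"
    using b_pos lam assms(1) by (auto simp: \<beta>_def)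
  have sin_beta: "sin t \<le> \<beta> / (8 * b) * sqrt (lam / B\<^sub>4)" for t
    unfolding beta(2) by (rule sin_le_one)
  have id: "truncated_activation \<sigma> a b (\<lambda>t. t) \<beta>"
    using identity_truncation[OF beta(1)] activation_axioms by (simp add: truncated_activation_def)
  have sur: "RGA (a * lam / (8 * b * sqrt B\<^sub>4)) x xs g"
    if "x \<in> sphere 0 1" "0 < sph_angle x xs"
      "sph_angle x xs \<le> min (arctan (a * lam / (4 * b * sqrt B\<^sub>4))) (arctan (\<gamma> * sqrt (lam / (4 * B\<^sub>4))))"
      "g \<in> riem_clarke_subdiff (f_sur D \<sigma> xs) x" for x g
    using RGA_of_sample_loss[OF id surrogate_loss _ _ lam gam unit unit_sphere[OF that(1)] low that(2)
        _ _ sin_beta _ that(4)] that(3)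
    by (simp add: f_sur_def surrogate_eq)
  have l2: "RGA (a\<^sup>2 * lam / (8 * b\<^sup>2 * sqrt B\<^sub>4)) x xs g"
    if "x \<in> sphere 0 1" "0 < sph_angle x xs"
      "sph_angle x xs \<le> min (arctan (a\<^sup>2 * lam / (4 * b\<^sup>2 * sqrt B\<^sub>4))) (arctan (\<gamma> * sqrt (lam / (4 * B\<^sub>4))))"
      "g \<in> riem_clarke_subdiff (f_L2 D \<sigma> xs) x" for x g
  proof -
    interpret I: truncated_activation \<sigma> a b "\<lambda>t. t" \<beta> by (rule id)
    have "sample_loss (\<lambda>u w. 1/2 * (\<sigma> u - \<sigma> w)\<^sup>2) (\<lambda>u w. \<sigma> u - \<sigma> w) b b a (2 * b\<^sup>2)"
    proof (rule I.composite_loss)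
      show "1/2 * s\<^sup>2 + s * (t - s) \<le> 1/2 * t\<^sup>2" for s t :: real
        using zero_le_power2[of "t - s"] by (simp add: power2_eq_square algebra_simps)
    qed (auto intro!: continuous_intros)
    from RGA_of_sample_loss[OF id this assms(9,10) lam gam unit unit_sphere[OF that(1)] low that(2)
        _ _ sin_beta _ that(4)] that(3)
    show ?thesis by (simp add: f_L2_def power2_eq_square)
  qed
  have hub: "RGA (a\<^sup>2 * lam / (8 * b\<^sup>2 * sqrt B\<^sub>4)) x xs g"
    if \<alpha>: "0 < \<alpha>" and x: "x \<in> sphere 0 1" and pos: "0 < sph_angle x xs"
      and le: "sph_angle x xs \<le> min (arctan (a\<^sup>2 * lam / (4 * b\<^sup>2 * sqrt B\<^sub>4)))
        (min (arctan (\<gamma> / 2 * sqrt (lam / B\<^sub>4))) (arcsin (min 1 (\<alpha> / (8 * b) * sqrt (lam / B\<^sub>4)))))"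
      and g: "g \<in> riem_clarke_subdiff (f_Hub D \<sigma> \<alpha> xs) x" for x g \<alpha>
  proof -
    interpret T: truncation "clip \<alpha>" \<alpha> by (rule clip_truncation[OF \<alpha>])
    have act: "truncated_activation \<sigma> a b (clip \<alpha>) \<alpha>" by unfold_locales
    interpret I: truncated_activation \<sigma> a b "clip \<alpha>" \<alpha> by (rule act)
    have loss: "sample_loss (\<lambda>u w. huber \<alpha> (\<sigma> u - \<sigma> w)) (\<lambda>u w. clip \<alpha> (\<sigma> u - \<sigma> w)) b b a (2 * b\<^sup>2)"
    proof (rule I.composite_loss)
      show "huber \<alpha> s + clip \<alpha> s * (t - s) \<le> huber \<alpha> t" for s t by (rule huber_subgradient[OF \<alpha>])
      show "huber \<alpha> 0 = 0" using \<alpha> by (simp add: huber_def)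
      show "continuous_on UNIV (huber \<alpha>)"
        unfolding huber_eq[OF \<alpha>, abs_def] clip_def by (intro continuous_intros) auto
    qed
    let ?T = "\<alpha> / (8 * b) * sqrt (lam / B\<^sub>4)"
    have T: "0 \<le> ?T" using \<alpha> b_pos lam assms(1) by simp
    have "sin (sph_angle x xs) \<le> sin (arcsin (min 1 ?T))"
      using le pos T arcsin_bounded[of "min 1 ?T"] by (intro sin_monotone_2pi_le) auto
    also have "\<dots> = min 1 ?T" using T by (intro sin_arcsin) auto
    finally have sin_le: "sin (sph_angle x xs) \<le> ?T" by simp
    have gam_eq: "\<gamma> / 2 * sqrt (lam / B\<^sub>4) = \<gamma> * sqrt (lam / (4 * B\<^sub>4))"
      by (simp add: real_sqrt_divide real_sqrt_mult)
    have "sph_angle x xs \<le> arctan (\<gamma> / 2 * sqrt (lam / B\<^sub>4))" using le by simp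
    then have "sph_angle x xs \<le> arctan (\<gamma> * sqrt (lam / (4 * B\<^sub>4)))" unfolding gam_eq .
    from RGA_of_sample_loss[OF act loss assms(9,10) lam gam unit unit_sphere[OF x] low pos
        _ this sin_le _ g] le
    show ?thesis by (simp add: f_Hub_def power2_eq_square)
  qed
  show ?thesis using sur l2 hub by blast
qed

end
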